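(* Let $\gamma$ be a quasilocal POS on a countable color space $E$. If there exists a dust-rate matrix $\alpha$ for $\gamma$ such that $\Gamma:=\sup_{y\in S}\sum_{x\le y}\alpha_{y,x}<1$, then $|\mathcal G(\gamma)|\le1$.
   Context: $(S,\le)$ is a countable partially ordered set. For $x\in S$ write $x_-=\{y\in S:y<x\}$, $x_+=\{y\in S:y>x\}$. For $\Upsilon\subset S$: $\max(\Upsilon)=\{x\in\Upsilon: y\notin\Upsilon\text{ for all }y>x\}$, $\min(\Upsilon)=\{x\in\Upsilon: y\notin\Upsilon\text{ for all }y<x\}$, the past $\Upsilon_-=\{x\in S\setminus\Upsilon:\exists y\in\Upsilon,\ x<y\}$, the future $\Upsilon_+=\{x\in S\setminus\Upsilon:\exists y\in\Upsilon,\ x>y\}$, and the outer time $\Upsilon^*=\{x\in S: x\text{ is comparable with no }y\in\Upsilon\}$. Standing assumptions: for every $x\in S$, $\max(x_-)$ and $\min(x_+)$ are finite, every $y<x$ satisfies $y\le y_0<x$ for some $y_0\in\max(x_-)$, every $z>x$ satisfies $z\ge z_0>x$ for some $z_0\in\min(x_+)$; and $S$ has no minimal element. A finite set $\Lambda\subset S$ is a time box if $\Lambda_-\cap\Lambda_+=\emptyset$. $\Omega=E^S$ with product $\sigma$-algebra $\mathcal F$ ($E$ with its discrete $\sigma$-algebra); $\mathcal F_\Upsilon$ is generated by coordinates in $\Upsilon$; local means $\mathcal F_\Delta$-measurable for some finite $\Delta$. A proper oriented kernel on a time box $\Lambda$ is a map $\gamma_\Lambda:\mathcal F_{S\setminus\Lambda_+}\times\Omega\to[0,1]$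 such that (a) $\gamma_\Lambda(\cdot,\omega)$ is a probability measure; (b) $\gamma_\Lambda(A,\cdot)$ is $\mathcal F_{\Lambda_-\cup\Lambda^*}$-measurable for $A\in\mathcal F_{S\setminus\Lambda_+}$; (c) $\gamma_\Lambda(A,\cdot)$ is $\mathcal F_{\Lambda_-}$-measurable for $A\in\mathcal F_\Lambda$; (d) $\gamma_\Lambda(B,\omega)=\mathbf 1_B(\omega)$ for $B\in\mathcal F_{\Lambda_-\cup\Lambda^*}$. Write $\gamma_\Lambda f(\omega)=\gamma_\Lambda(f\mid\omega)=\int f\,d\gamma_\Lambda(\cdot,\omega)$; compositions $(\gamma_\Delta\gamma_\Lambda)(f\mid\omega)=\int\gamma_\Lambda(f\mid\sigma)\gamma_\Delta(d\sigma,\omega)$, $(\mu\gamma_\Lambda)(f)=\int\gamma_\Lambda(f\mid\sigma)\mu(d\sigma)$. A POS is a family $\gamma=(\gamma_\Lambda)$ of proper oriented kernels indexed by all time boxes with $\gamma_\Delta\gamma_\Lambda=\gamma_\Delta$ on $\mathcal F_{S\setminus\Lambda_+}$ whenever $\Lambda\subset\Delta$; $\gamma_y=\gamma_{\{y\}}$. $\mathcal G(\gamma)$ is the set of probability measures $\mu$ with $\mu\gamma_\Lambda=\mu$ on $\mathcal F_{S\setminus\Lambda_+}$ for all time boxes. A function $f$ is quasilocal if for every $\varepsilon>0$ there is a finite $\Lambda$ with $\sup_{\omega_\Lambda=\sigma_\Lambda}|f(\omega)-f(\sigma)|<\varepsilon$; the POS is quasilocal if $\gamma_\Lambda(A,\cdot)$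 is quasilocal for every time box $\Lambda$ and local event $A\in\mathcal F_{S\setminus\Lambda_+}$. For $\xi,\eta\in\Omega$ and $x\in S$, $\xi\overset{x}{=}\eta$ means $\xi_z=\eta_z$ for all $z\ne x$; the oscillation of $f$ at $x$ is $\delta_x(f)=\sup_{\xi\overset{x}{=}\eta}|f(\xi)-f(\eta)|$. A dust-rate matrix is a family $(\alpha_{y,x})_{x\le y}$ of nonnegative reals with $\alpha_{y,y}=0$ for all $y$ and $\delta_x(\gamma_y f)\le\delta_y(f)\,\alpha_{y,x}$ for all $y\in S$, $x\in y_-$ and all bounded $\mathcal F_{\{y\}}$-measurable $f$. *)

theory Defs
  imports "HOL-Probability.Probability" "HOL-Library.Countable"
begin

definition below :: "'s::order \<Rightarrow> 's set" where
  "below x = {y. y < x}"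

definition above :: "'s::order \<Rightarrow> 's set" where
  "above x = {y. y > x}"

definition maxs :: "'s::order set \<Rightarrow> 's set" where
  "maxs U = {x\<in>U. \<forall>y. y > x \<longrightarrow> y \<notin> U}"

definition mins :: "'s::order set \<Rightarrow> 's set" where
  "mins U = {x\<in>U. \<forall>y. y < x \<longrightarrow> y \<notin> U}"

definition Past :: "'s::order set \<Rightarrow> 's set" where
  "Past U = {x. x \<notin> U \<and> (\<exists>y\<in>U. x < y)}"

definition Fut :: "'s::order set \<Rightarrow> 's set" where
  "Fut U = {x. x \<notin> U \<and> (\<exists>y\<in>U. x > y)}"

definition Outer :: "'s::order set \<Rightarrow> 's set" where
  "Outer U = {x. \<forall>y\<in>U. \<not> (x \<le> y \<or> y \<le> x)}"

definition standing_assms :: "'s::order itself \<Rightarrow> bool" where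
  "standing_assms _ \<longleftrightarrow>
     (\<forall>x::'s. finite (maxs (below x)) \<and> finite (mins (above x))
        \<and> (\<forall>y. y < x \<longrightarrow> (\<exists>y0\<in>maxs (below x). y \<le> y0))
        \<and> (\<forall>z. z > x \<longrightarrow> (\<exists>z0\<in>mins (above x). z0 \<le> z)))
     \<and> (\<forall>x::'s. \<exists>y. y < x)"

definition time_box :: "'s::order set \<Rightarrow> bool" where
  "time_box L \<longleftrightarrow> finite L \<and> Past L \<inter> Fut L = {}"

text \<open>\<Omega> = E^S is the type 's \<Rightarrow> 'e; F_U is generated by the coordinates in U
  (E carries the discrete sigma-algebra, so cylinder events {\<omega>. \<omega> x = e} generate).\<close>

definition Fsets :: "'s set \<Rightarrow> ('s \<Rightarrow> 'e) set set" where
  "Fsets U = sigma_sets UNIV {{\<omega>. \<omega> x = e} | x e. x \<in> U}"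

definition OmegaOn :: "'s set \<Rightarrow> ('s \<Rightarrow> 'e) measure" where
  "OmegaOn U = sigma UNIV {{\<omega>. \<omega> x = e} | x e. x \<in> U}"

definition local_event :: "('s \<Rightarrow> 'e) set \<Rightarrow> bool" where
  "local_event A \<longleftrightarrow> (\<exists>D. finite D \<and> A \<in> Fsets D)"

text \<open>A kernel on a time box L is a function gL :: event \<Rightarrow> configuration \<Rightarrow> real,
  only meaningful on events of F_{S - L_+}.\<close>

definition kmeasure :: "('s::order set \<Rightarrow> ('s \<Rightarrow> 'e) set \<Rightarrow> ('s \<Rightarrow> 'e) \<Rightarrow> real)
    \<Rightarrow> 's set \<Rightarrow> ('s \<Rightarrow> 'e) \<Rightarrow> ('s \<Rightarrow> 'e) measure" where
  "kmeasure g L \<omega> = measure_of UNIV (Fsets (- Fut L)) (\<lambda>A. ennreal (g L A \<omega>))"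

definition kint :: "('s::order set \<Rightarrow> ('s \<Rightarrow> 'e) set \<Rightarrow> ('s \<Rightarrow> 'e) \<Rightarrow> real)
    \<Rightarrow> 's set \<Rightarrow> (('s \<Rightarrow> 'e) \<Rightarrow> real) \<Rightarrow> ('s \<Rightarrow> 'e) \<Rightarrow> real" where
  "kint g L f \<omega> = (\<integral>\<sigma>. f \<sigma> \<partial>kmeasure g L \<omega>)"

definition proper_oriented_kernel ::
    "(('s::order \<Rightarrow> 'e) set \<Rightarrow> ('s \<Rightarrow> 'e) \<Rightarrow> real) \<Rightarrow> 's set \<Rightarrow> bool" where
  "proper_oriented_kernel gL L \<longleftrightarrow>
     \<comment> \<open>(a) probability measure on F_{S - L_+}\<close>
     (\<forall>\<omega>. measure_space UNIV (Fsets (- Fut L)) (\<lambda>A. ennreal (gL A \<omega>))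
          \<and> (\<forall>A\<in>Fsets (- Fut L). 0 \<le> gL A \<omega> \<and> gL A \<omega> \<le> 1)
          \<and> gL UNIV \<omega> = 1)
     \<comment> \<open>(b)\<close>
   \<and> (\<forall>A\<in>Fsets (- Fut L). (\<lambda>\<omega>. gL A \<omega>) \<in> borel_measurable (OmegaOn (Past L \<union> Outer L)))
     \<comment> \<open>(c)\<close>
   \<and> (\<forall>A\<in>Fsets L. (\<lambda>\<omega>. gL A \<omega>) \<in> borel_measurable (OmegaOn (Past L)))
     \<comment> \<open>(d)\<close>
   \<and> (\<forall>B\<in>Fsets (Past L \<union> Outer L). \<forall>\<omega>. gL B \<omega> = indicator B \<omega>)"

text \<open>POS: proper oriented kernels on every time box, consistent under composition
  (for events in F_{S - L_+} on which the composition gamma_D gamma_L is defined).\<close>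

definition is_POS :: "('s::order set \<Rightarrow> ('s \<Rightarrow> 'e) set \<Rightarrow> ('s \<Rightarrow> 'e) \<Rightarrow> real) \<Rightarrow> bool" where
  "is_POS g \<longleftrightarrow>
     (\<forall>L. time_box L \<longrightarrow> proper_oriented_kernel (g L) L)
   \<and> (\<forall>L D. time_box L \<and> time_box D \<and> L \<subseteq> D \<longrightarrow>
        (\<forall>A \<in> Fsets (- Fut L) \<inter> Fsets (- Fut D).
           (\<lambda>\<sigma>. g L A \<sigma>) \<in> borel_measurable (OmegaOn (- Fut D)) \<longrightarrow>
           (\<forall>\<omega>. (\<integral>\<sigma>. g L A \<sigma> \<partial>kmeasure g D \<omega>) = g D A \<omega>)))"

definition Gibbs :: "('s::order set \<Rightarrow> ('s \<Rightarrow> 'e) set \<Rightarrow> ('s \<Rightarrow> 'e) \<Rightarrow> real)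
    \<Rightarrow> ('s \<Rightarrow> 'e) measure set" where
  "Gibbs g = {\<mu>. prob_space \<mu> \<and> sets \<mu> = Fsets UNIV \<and>
     (\<forall>L. time_box L \<longrightarrow>
        (\<forall>A\<in>Fsets (- Fut L). (\<integral>\<sigma>. g L A \<sigma> \<partial>\<mu>) = measure \<mu> A))}"

definition quasilocal :: "(('s \<Rightarrow> 'e) \<Rightarrow> real) \<Rightarrow> bool" where
  "quasilocal f \<longleftrightarrow> (\<forall>\<epsilon>>0. \<exists>L. finite L \<and>
     (\<forall>\<omega> \<sigma>. (\<forall>x\<in>L. \<omega> x = \<sigma> x) \<longrightarrow> \<bar>f \<omega> - f \<sigma>\<bar> < \<epsilon>))"

definition quasilocal_POS :: "('s::order set \<Rightarrow> ('s \<Rightarrow> 'e) set \<Rightarrow> ('s \<Rightarrow> 'e) \<Rightarrow> real) \<Rightarrow> bool" where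
  "quasilocal_POS g \<longleftrightarrow> (\<forall>L. time_box L \<longrightarrow>
     (\<forall>A\<in>Fsets (- Fut L). local_event A \<longrightarrow> quasilocal (\<lambda>\<omega>. g L A \<omega>)))"

definition osc :: "'s \<Rightarrow> (('s \<Rightarrow> 'e) \<Rightarrow> real) \<Rightarrow> real" where
  "osc x f = Sup {\<bar>f \<xi> - f \<eta>\<bar> | \<xi> \<eta>. \<forall>z. z \<noteq> x \<longrightarrow> \<xi> z = \<eta> z}"

definition dust_rate :: "('s::order set \<Rightarrow> ('s \<Rightarrow> 'e) set \<Rightarrow> ('s \<Rightarrow> 'e) \<Rightarrow> real)
    \<Rightarrow> ('s \<Rightarrow> 's \<Rightarrow> real) \<Rightarrow> bool" where
  "dust_rate g \<alpha> \<longleftrightarrow>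
     (\<forall>x y. x \<le> y \<longrightarrow> 0 \<le> \<alpha> y x)
   \<and> (\<forall>y. \<alpha> y y = 0)
   \<and> (\<forall>y x f. x < y \<longrightarrow> f \<in> borel_measurable (OmegaOn {y}) \<longrightarrow> (\<exists>B. \<forall>\<omega>. \<bar>f \<omega>\<bar> \<le> B) \<longrightarrow>
        osc x (kint g {y} f) \<le> osc y f * \<alpha> y x)"

end

theory Submission
  imports Defs
begin

text \<open>
  Resampling a site \<open>y\<close> with \<open>\<gamma>\<^sub>y\<close> leaves the integrals under all Gibbs measures unchanged; it
  removes the oscillation of \<open>f\<close> at \<open>y\<close> and adds at most \<open>\<delta>\<^sub>y(f) \<alpha>\<^sub>y\<^sub>,\<^sub>x\<close> at each \<open>x < y\<close>. Starting
  from a local \<open>f\<close>, and however many distinct sites are resampled from the top downwards, the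
  oscillation at \<open>x\<close> never exceeds \<open>M\<^sub>x = (\<Sum>\<^sub>n \<delta>(f) \<alpha>\<^sup>n)\<^sub>x\<close>, and \<open>\<Gamma> < 1\<close> makes \<open>M\<close> summable. Between two
  comparable sites there may be infinitely many others, so not every site can be resampled:
  choose a finite \<open>X\<close> outside of which \<open>M\<close> has mass at most \<open>\<epsilon>\<close>, resample \<open>X\<close>, and freeze every
  other site that gets in the way. Freezing changes each integral by at most \<open>\<epsilon>\<close> in total, by
  quasilocality, and what remains at the end is constant up to oscillation \<open>\<epsilon>\<close>.
\<close>

section \<open>Dependence on coordinates and the sigma-algebras \<open>Fsets\<close>\<close>

text \<open>A pointwise substitute for measurability with respect to \<open>Fsets V\<close>. The two
  notions are linked by \<open>measurable_depends_on\<close> and, for bounded quasilocal functions,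
  by \<open>quasilocal_measurable\<close>, so the resampling argument can work with dependence and
  quasilocality.\<close>

definition depends_on :: "'s set \<Rightarrow> (('s \<Rightarrow> 'e) \<Rightarrow> 'b) \<Rightarrow> bool" where
  "depends_on V f \<longleftrightarrow> (\<forall>\<omega> \<sigma>. (\<forall>x\<in>V. \<omega> x = \<sigma> x) \<longrightarrow> f \<omega> = f \<sigma>)"

lemma depends_onD: "depends_on V f \<Longrightarrow> (\<And>x. x \<in> V \<Longrightarrow> \<omega> x = \<sigma> x) \<Longrightarrow> f \<omega> = f \<sigma>"
  unfolding depends_on_def by blast

lemma depends_on_mono: "depends_on V f \<Longrightarrow> V \<subseteq> W \<Longrightarrow> depends_on W f"
  unfolding depends_on_def by blast

lemma depends_on_UNIV [simp]: "depends_on UNIV f"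
  by (simp add: depends_on_def fun_eq_iff[symmetric])

lemma sets_OmegaOn [simp]: "sets (OmegaOn U) = Fsets U"
  unfolding OmegaOn_def Fsets_def by (rule sets_measure_of) simp

lemma space_OmegaOn [simp]: "space (OmegaOn U) = UNIV"
  unfolding OmegaOn_def by (rule space_measure_of) simp

lemma Fsets_mono: "U \<subseteq> V \<Longrightarrow> Fsets U \<subseteq> Fsets V"
  unfolding Fsets_def by (rule sigma_sets_mono') auto

lemma sigma_algebra_Fsets: "sigma_algebra UNIV (Fsets U)"
  using sets.sigma_algebra_axioms[of "OmegaOn U"] by simp

text \<open>Countability of \<open>S\<close> turns this into a countable intersection of
  one-coordinate events. Infinite \<open>U\<close> matters: \<open>kint_resample\<close> fixes all
  sites off \<open>y\<close> and its future at once.\<close>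

lemma cylinder_in_Fsets: "{\<sigma>. \<forall>x\<in>U. \<sigma> x = \<omega> x} \<in> Fsets U"
  for U :: "'s::countable set"
proof -
  have "{\<sigma> \<in> space (OmegaOn U). \<forall>x. x \<in> U \<longrightarrow> \<sigma> x = \<omega> x} \<in> sets (OmegaOn U)"
  proof (rule sets.sets_Collect_countable_All)
    fix x
    show "{\<sigma> \<in> space (OmegaOn U). x \<in> U \<longrightarrow> \<sigma> x = \<omega> x} \<in> sets (OmegaOn U)"
    proof (cases "x \<in> U")
      case True
      then have "{\<sigma>. \<sigma> x = \<omega> x} \<in> Fsets U"
        unfolding Fsets_def by (intro sigma_sets.Basic) auto
      with True show ?thesis by simp
    next
      case False
      then show ?thesis using sets.top[of "OmegaOn U"] by simp
    qed
  qed
  then show ?thesis by (simp add: Ball_def)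
qed

text \<open>Since \<open>E\<close> is countable, only countably many patterns can occur on
  \<open>L\<close>, and \<open>A\<close> is the union of their cylinders.\<close>

lemma finite_dependence_in_Fsets:
  fixes A :: "('s::countable \<Rightarrow> 'e::countable) set"
  assumes "finite L" "depends_on L (\<lambda>\<omega>. \<omega> \<in> A)"
  shows "A \<in> Fsets L"
proof -
  define R where "R = (\<lambda>\<omega>. restrict \<omega> L) ` A"
  have "R \<subseteq> Pi\<^sub>E L (\<lambda>_. UNIV)" unfolding R_def by auto
  then have "countable R"
    using countable_PiE[OF assms(1), of "\<lambda>_. UNIV :: 'e set"] countable_subset by auto
  moreover have "A = (\<Union>r\<in>R. {\<sigma>. \<forall>x\<in>L. \<sigma> x = r x})"
  proof (intro set_eqI iffI)
    fix \<omega> assume "\<omega> \<in> A"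
    then show "\<omega> \<in> (\<Union>r\<in>R. {\<sigma>. \<forall>x\<in>L. \<sigma> x = r x})"
      unfolding R_def by auto
  next
    fix \<omega> assume "\<omega> \<in> (\<Union>r\<in>R. {\<sigma>. \<forall>x\<in>L. \<sigma> x = r x})"
    then obtain \<sigma> where "\<sigma> \<in> A" "\<forall>x\<in>L. \<omega> x = \<sigma> x"
      unfolding R_def by auto
    then show "\<omega> \<in> A" using assms(2) unfolding depends_on_def by blast
  qed
  moreover have "(\<Union>r\<in>R. {\<sigma>. \<forall>x\<in>L. \<sigma> x = r x}) \<in> sets (OmegaOn L)"
    using \<open>countable R\<close> by (intro sets.countable_UN') (auto simp: cylinder_in_Fsets)
  ultimately show ?thesis by simp
qed

section \<open>Approximation and integration of quasilocal functions\<close>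

text \<open>Freezing all coordinates off a finite set and then rounding down to a grid of mesh
  \<open>\<epsilon> / 2\<close> costs at most \<open>\<epsilon> / 2\<close> each; boundedness leaves
  finitely many values. This carries the kernel axioms, which speak of events, over to
  functions.\<close>

lemma quasilocal_simple_approx:
  fixes f :: "('s::countable \<Rightarrow> 'e::countable) \<Rightarrow> real"
  assumes ql: "quasilocal f" and bd: "\<And>\<omega>. \<bar>f \<omega>\<bar> \<le> B" and dep: "depends_on V f" and "\<epsilon> > 0"
  obtains L I A where "finite L" "L \<subseteq> V" "finite I" "\<And>v. A v \<in> Fsets L"
    "\<And>\<omega>. \<bar>f \<omega> - (\<Sum>v\<in>I. v * indicator (A v) \<omega>)\<bar> \<le> \<epsilon>"
proof -
  define e where "e = \<epsilon> / 2"
  have e: "e > 0" using \<open>\<epsilon> > 0\<close> by (simp add: e_def)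
  obtain L0 where L0: "finite L0" "\<And>\<omega> \<sigma>. (\<forall>x\<in>L0. \<omega> x = \<sigma> x) \<Longrightarrow> \<bar>f \<omega> - f \<sigma>\<bar> < e"
    using ql e unfolding quasilocal_def by meson
  define L where "L = L0 \<inter> V"
  define f1 where "f1 \<omega> = f (\<lambda>x. if x \<in> L then \<omega> x else undefined)" for \<omega>
  define g where "g \<omega> = e * of_int \<lfloor>f1 \<omega> / e\<rfloor>" for \<omega>
  define A where "A v = {\<omega>. g \<omega> = v}" for v
  have f1: "\<bar>f \<omega> - f1 \<omega>\<bar> \<le> e" for \<omega>
  proof -
    \<comment> \<open>This configuration gives \<open>f\<close> the same value as
      \<open>\<omega>\<close> and agrees on all of \<open>L0\<close> with the truncated one used in
      \<open>f1\<close>.\<close>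
    define \<omega>' where "\<omega>' x = (if x \<in> V then \<omega> x else undefined)" for x
    have "f \<omega> = f \<omega>'" using dep by (rule depends_onD) (simp add: \<omega>'_def)
    moreover have "\<bar>f \<omega>' - f1 \<omega>\<bar> < e"
      unfolding f1_def by (rule L0(2)) (auto simp: \<omega>'_def L_def)
    ultimately show ?thesis by simp
  qed
  have g: "\<bar>f1 \<omega> - g \<omega>\<bar> \<le> e" for \<omega>
  proof -
    have "\<bar>f1 \<omega> / e - of_int \<lfloor>f1 \<omega> / e\<rfloor>\<bar> \<le> 1" by linarith
    then have "e * \<bar>f1 \<omega> / e - of_int \<lfloor>f1 \<omega> / e\<rfloor>\<bar> \<le> e * 1"
      using e by (intro mult_left_mono) auto
    moreover have "e * \<bar>f1 \<omega> / e - of_int \<lfloor>f1 \<omega> / e\<rfloor>\<bar> = \<bar>f1 \<omega> - g \<omega>\<bar>"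
      using abs_mult[of e "f1 \<omega> / e - of_int \<lfloor>f1 \<omega> / e\<rfloor>"] e
      by (simp add: g_def right_diff_distrib)
    ultimately show ?thesis by simp
  qed
  have "range g \<subseteq> (\<lambda>k. e * of_int k) ` {\<lfloor>- B / e\<rfloor>..\<lfloor>B / e\<rfloor>}"
  proof
    fix v assume "v \<in> range g"
    then obtain \<omega> where v: "v = g \<omega>" by auto
    have "\<bar>f1 \<omega>\<bar> \<le> B" unfolding f1_def by (rule bd)
    then have "- B / e \<le> f1 \<omega> / e" "f1 \<omega> / e \<le> B / e"
      using e by (auto intro!: divide_right_mono simp del: divide_minus_left)
    then have "\<lfloor>f1 \<omega> / e\<rfloor> \<in> {\<lfloor>- B / e\<rfloor>..\<lfloor>B / e\<rfloor>}"
      unfolding atLeastAtMost_iff by (intro conjI floor_mono)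
    then show "v \<in> (\<lambda>k. e * of_int k) ` {\<lfloor>- B / e\<rfloor>..\<lfloor>B / e\<rfloor>}"
      unfolding v g_def by blast
  qed
  then have fin: "finite (range g)" by (rule finite_subset) simp
  have "finite L" "L \<subseteq> V" using L0(1) by (auto simp: L_def)
  moreover have "A v \<in> Fsets L" for v
  proof (rule finite_dependence_in_Fsets)
    have "g \<omega> = g \<sigma>" if "\<forall>x\<in>L. \<omega> x = \<sigma> x" for \<omega> \<sigma>
    proof -
      have "(\<lambda>x. if x \<in> L then \<omega> x else undefined) = (\<lambda>x. if x \<in> L then \<sigma> x else undefined)"
        using that by auto
      then show ?thesis by (simp add: g_def f1_def)
    qed
    then show "depends_on L (\<lambda>\<omega>. \<omega> \<in> A v)" unfolding depends_on_def A_def by auto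
  qed fact
  moreover have "\<bar>f \<omega> - (\<Sum>v\<in>range g. v * indicator (A v) \<omega>)\<bar> \<le> \<epsilon>" for \<omega>
  proof -
    have "(\<Sum>v\<in>range g. v * indicator (A v) \<omega>) = (\<Sum>v\<in>range g. if v = g \<omega> then v else 0)"
      by (intro sum.cong) (auto simp: A_def)
    also have "\<dots> = g \<omega>" using fin by simp
    finally have eq: "(\<Sum>v\<in>range g. v * indicator (A v) \<omega>) = g \<omega>" .
    show ?thesis unfolding eq using f1[of \<omega>] g[of \<omega>] unfolding e_def by linarith
  qed
  ultimately show ?thesis using that fin by blast
qed

text \<open>The simple approximants with error \<open>1 / Suc n\<close> are measurable, and
  \<open>f\<close> is their uniform limit.\<close>

lemma quasilocal_measurable:
  fixes f :: "('s::countable \<Rightarrow> 'e::countable) \<Rightarrow> real"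
  assumes ql: "quasilocal f" and bd: "\<And>\<omega>. \<bar>f \<omega>\<bar> \<le> B" and dep: "depends_on V f"
  shows "f \<in> borel_measurable (OmegaOn V)"
proof -
  have "\<exists>h. h \<in> borel_measurable (OmegaOn V) \<and> (\<forall>\<omega>. \<bar>f \<omega> - h \<omega>\<bar> \<le> 1 / Suc n)" for n
  proof -
    obtain L I A where *: "finite L" "L \<subseteq> V" "finite I" "\<And>v. A v \<in> Fsets L"
      "\<And>\<omega>. \<bar>f \<omega> - (\<Sum>v\<in>I. v * indicator (A v) \<omega>)\<bar> \<le> 1 / Suc n"
      by (rule quasilocal_simple_approx[OF assms, of "1 / Suc n"]) auto
    have "A v \<in> sets (OmegaOn V)" for v using Fsets_mono[OF *(2)] *(4) by auto
    then have "(\<lambda>\<omega>. \<Sum>v\<in>I. v * indicator (A v) \<omega>) \<in> borel_measurable (OmegaOn V)"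
      by (intro borel_measurable_sum borel_measurable_times borel_measurable_const
          borel_measurable_indicator)
    then show ?thesis using *(5) by blast
  qed
  then obtain h where h: "\<And>n. h n \<in> borel_measurable (OmegaOn V)"
    "\<And>n \<omega>. \<bar>f \<omega> - h n \<omega>\<bar> \<le> 1 / Suc n" by metis
  show ?thesis
  proof (rule borel_measurable_LIMSEQ_real[OF _ h(1)])
    fix \<omega>
    have "(\<lambda>n. h n \<omega> - f \<omega>) \<longlonglongrightarrow> 0"
    proof (rule Lim_null_comparison)
      show "\<forall>\<^sub>F n in sequentially. norm (h n \<omega> - f \<omega>) \<le> 1 / Suc n"
        using h(2)[of \<omega>] by (simp add: abs_minus_commute)
      show "(\<lambda>n. 1 / real (Suc n)) \<longlonglongrightarrow> 0"
        using LIMSEQ_inverse_real_of_nat by (simp add: inverse_eq_divide)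
    qed
    then show "(\<lambda>n. h n \<omega>) \<longlonglongrightarrow> f \<omega>" by (rule LIM_zero_cancel)
  qed
qed

text \<open>Applied with \<open>P\<close> a kernel measure and with \<open>P\<close> a Gibbs
  measure, this reduces identities between integrals to the events \<open>A v\<close>.\<close>

lemma integral_simple_approx:
  fixes f :: "'a \<Rightarrow> real"
  assumes "prob_space P" "f \<in> borel_measurable P" and bd: "\<And>\<omega>. \<bar>f \<omega>\<bar> \<le> B"
    and "finite I" and A: "\<And>v. A v \<in> sets P"
    and ap: "\<And>\<omega>. \<bar>f \<omega> - (\<Sum>v\<in>I. v * indicator (A v) \<omega>)\<bar> \<le> \<epsilon>"
  shows "\<bar>(\<integral>\<omega>. f \<omega> \<partial>P) - (\<Sum>v\<in>I. v * measure P (A v))\<bar> \<le> \<epsilon>"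
proof -
  interpret prob_space P by fact
  have f: "integrable P f" using assms(2) bd by (intro integrable_const_bound[of _ B]) auto
  have i: "integrable P (\<lambda>\<omega>. v * indicator (A v) \<omega> :: real)" for v
    using A by (intro integrable_mult_right integrable_real_indicator) (auto simp: emeasure_eq_measure)
  have s: "(\<integral>\<omega>. (\<Sum>v\<in>I. v * indicator (A v) \<omega>) \<partial>P) = (\<Sum>v\<in>I. v * measure P (A v))"
    using i A sets.sets_into_space[OF A] by (subst Bochner_Integration.integral_sum) (auto simp: Int_absorb2)
  have "\<bar>\<integral>\<omega>. (f \<omega> - (\<Sum>v\<in>I. v * indicator (A v) \<omega>)) \<partial>P\<bar>
      \<le> (\<integral>\<omega>. \<bar>f \<omega> - (\<Sum>v\<in>I. v * indicator (A v) \<omega>)\<bar> \<partial>P)"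
    by (rule integral_abs_bound)
  also have "\<dots> \<le> (\<integral>\<omega>. \<epsilon> \<partial>P)"
    using f i ap by (intro integral_mono integrable_abs Bochner_Integration.integrable_diff
        Bochner_Integration.integrable_sum) auto
  also have "\<dots> = \<epsilon>" by (simp add: prob_space)
  finally show ?thesis
    using f i by (subst (asm) Bochner_Integration.integral_diff) (auto simp: s)
qed

lemma finite_dependence_quasilocal:
  assumes "finite L" "depends_on L f" shows "quasilocal f"
  unfolding quasilocal_def
proof (intro allI impI exI conjI)
  show "\<bar>f \<omega> - f \<sigma>\<bar> < \<epsilon>" if "\<epsilon> > 0" "\<forall>x\<in>L. \<omega> x = \<sigma> x" for \<epsilon> :: real and \<omega> \<sigma>
    using depends_onD[OF assms(2), of \<omega> \<sigma>] that by simp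
qed (rule assms(1))

lemma Fsets_depends_on: "A \<in> Fsets U \<Longrightarrow> depends_on U (\<lambda>\<omega>. \<omega> \<in> A)"
  unfolding Fsets_def
proof (induction rule: sigma_sets.induct)
  case (Basic A)
  then show ?case by (auto simp: depends_on_def)
next
  case Empty
  then show ?case by (simp add: depends_on_def)
next
  case (Compl A)
  then show ?case unfolding depends_on_def by blast
next
  case (Union A)
  then show ?case unfolding depends_on_def by blast
qed

text \<open>The level set of \<open>f\<close> through \<open>\<omega>\<close> is an event of
  \<open>Fsets U\<close>, so it cannot separate configurations that agree on
  \<open>U\<close>.\<close>

lemma measurable_depends_on:
  fixes f :: "('s \<Rightarrow> 'e) \<Rightarrow> real"
  assumes "f \<in> borel_measurable (OmegaOn U)" shows "depends_on U f"
  unfolding depends_on_def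
proof (intro allI impI)
  fix \<omega> \<sigma> :: "'s \<Rightarrow> 'e" assume eq: "\<forall>x\<in>U. \<omega> x = \<sigma> x"
  have "f -` {f \<omega>} \<inter> space (OmegaOn U) \<in> sets (OmegaOn U)"
    using assms by (rule measurable_sets) simp
  then have "depends_on U (\<lambda>\<tau>. \<tau> \<in> f -` {f \<omega>})" by (intro Fsets_depends_on) simp
  then have "\<sigma> \<in> f -` {f \<omega>}" using eq unfolding depends_on_def by fastforce
  then show "f \<omega> = f \<sigma>" by simp
qed

text \<open>Finitely many changes are made one site at a time, each paid for by its oscillation
  bound. Without quasilocality this says nothing about infinitely many changes; with it, all but
  finitely many cost at most \<open>\<epsilon>\<close>.\<close>

lemma quasilocal_diff_le_infsum:
  fixes f :: "('s \<Rightarrow> 'e) \<Rightarrow> real"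
  assumes ql: "quasilocal f"
    and osc: "\<And>x \<xi> \<eta>. x \<in> W \<Longrightarrow> (\<And>z. z \<noteq> x \<Longrightarrow> \<xi> z = \<eta> z) \<Longrightarrow> \<bar>f \<xi> - f \<eta>\<bar> \<le> c x"
    and c: "c summable_on W" "\<And>x. x \<in> W \<Longrightarrow> 0 \<le> c x"
    and eq: "\<And>x. x \<notin> W \<Longrightarrow> \<omega> x = \<sigma> x"
  shows "\<bar>f \<omega> - f \<sigma>\<bar> \<le> infsum c W"
proof (rule field_le_epsilon)
  fix \<epsilon> :: real assume "\<epsilon> > 0"
  have finite_case: "\<bar>f \<omega> - f \<tau>\<bar> \<le> sum c F"
    if "finite F" "F \<subseteq> W" "\<And>x. x \<notin> F \<Longrightarrow> \<omega> x = \<tau> x" for F \<tau>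
    using that
  proof (induction F arbitrary: \<tau> rule: finite_induct)
    case empty
    then have "\<omega> = \<tau>" by auto
    then show ?case by simp
  next
    case (insert x F)
    \<comment> \<open>Restoring \<open>\<omega>\<close> at \<open>x\<close> leaves a discrepancy on
      \<open>F\<close> alone, which the induction hypothesis covers.\<close>
    have "\<bar>f \<omega> - f (\<tau>(x := \<omega> x))\<bar> \<le> sum c F"
      using insert.prems by (intro insert.IH) auto
    moreover have "\<bar>f (\<tau>(x := \<omega> x)) - f \<tau>\<bar> \<le> c x"
      using insert.prems by (intro osc) auto
    ultimately show ?case using insert.hyps by simp
  qed
  obtain L where L: "finite L" "\<And>\<omega> \<sigma>. (\<forall>x\<in>L. \<omega> x = \<sigma> x) \<Longrightarrow> \<bar>f \<omega> - f \<sigma>\<bar> < \<epsilon>"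
    using ql \<open>\<epsilon> > 0\<close> unfolding quasilocal_def by meson
  \<comment> \<open>An intermediate configuration: it differs from \<open>\<omega>\<close> only on a
    finite subset of \<open>W\<close> and agrees with \<open>\<sigma>\<close> on all of
    \<open>L\<close>.\<close>
  define \<tau> where "\<tau> x = (if x \<in> L \<inter> W then \<sigma> x else \<omega> x)" for x
  have "\<bar>f \<omega> - f \<tau>\<bar> \<le> sum c (L \<inter> W)"
    using L(1) by (intro finite_case) (auto simp: \<tau>_def)
  also have "\<dots> \<le> infsum c W"
    using L(1) c by (intro finite_sum_le_infsum) auto
  finally have "\<bar>f \<omega> - f \<tau>\<bar> \<le> infsum c W" .
  moreover have "\<bar>f \<tau> - f \<sigma>\<bar> < \<epsilon>" using eq by (intro L(2)) (auto simp: \<tau>_def)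
  ultimately show "\<bar>f \<omega> - f \<sigma>\<bar> \<le> infsum c W + \<epsilon>" by linarith
qed

lemma (in prob_space) integral_diff_le:
  fixes f h :: "'a \<Rightarrow> real"
  assumes "f \<in> borel_measurable M" "h \<in> borel_measurable M"
    and "\<And>\<omega>. \<bar>f \<omega>\<bar> \<le> B" "\<And>\<omega>. \<bar>h \<omega>\<bar> \<le> B'" "\<And>\<omega>. \<bar>f \<omega> - h \<omega>\<bar> \<le> S"
  shows "\<bar>(\<integral>\<omega>. f \<omega> \<partial>M) - (\<integral>\<omega>. h \<omega> \<partial>M)\<bar> \<le> S"
proof -
  have f: "integrable M f" using assms by (intro integrable_const_bound[of _ B]) auto
  have h: "integrable M h" using assms by (intro integrable_const_bound[of _ B']) auto
  have "\<bar>\<integral>\<omega>. f \<omega> - h \<omega> \<partial>M\<bar> \<le> (\<integral>\<omega>. \<bar>f \<omega> - h \<omega>\<bar> \<partial>M)" by (rule integral_abs_bound)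
  also have "\<dots> \<le> (\<integral>\<omega>. S \<partial>M)" using f h assms(5) by (intro integral_mono) auto
  finally show ?thesis using f h by (simp add: prob_space)
qed

section \<open>The single-site kernel and its action on functions\<close>

lemma Fut_singleton: "Fut {y} = above y"
  by (auto simp: Fut_def above_def)

lemma time_box_singleton: "time_box {y}"
  by (auto simp: time_box_def Past_def Fut_def)

lemma Past_singleton: "Past {y} = below y"
  by (auto simp: Past_def below_def)

text \<open>A site other than \<open>y\<close> is below, above or incomparable to \<open>y\<close>.
  Hence clause (d) of properness freezes everything except \<open>y\<close> and its future.\<close>

lemma Past_Outer_singleton: "Past {y} \<union> Outer {y} = - above y - {y}"
  by (auto simp: Past_def Outer_def above_def)

context
  fixes g :: "'s::{order,countable} set \<Rightarrow> ('s \<Rightarrow> 'e::countable) set \<Rightarrow> ('s \<Rightarrow> 'e) \<Rightarrow> real" and y :: 's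
  assumes proper: "proper_oriented_kernel (g {y}) {y}"
begin

lemma kernel_range: "A \<in> Fsets (- above y) \<Longrightarrow> 0 \<le> g {y} A \<omega> \<and> g {y} A \<omega> \<le> 1"
  using proper unfolding proper_oriented_kernel_def Fut_singleton by blast

lemma sets_kmeasure: "sets (kmeasure g {y} \<omega>) = Fsets (- above y)"
  unfolding kmeasure_def Fut_singleton
  using sigma_algebra.sets_measure_of_eq[OF sigma_algebra_Fsets] by blast

lemma space_kmeasure: "space (kmeasure g {y} \<omega>) = UNIV"
  unfolding kmeasure_def by (rule space_measure_of) simp

text \<open>Clause (a) of properness guarantees that \<open>measure_of\<close> returns the given set
  function and not the zero measure.\<close>

lemma emeasure_kmeasure:
  assumes "A \<in> Fsets (- above y)" shows "emeasure (kmeasure g {y} \<omega>) A = g {y} A \<omega>"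
proof -
  have "measure_space UNIV (Fsets (- above y)) (\<lambda>A. ennreal (g {y} A \<omega>))"
    using proper unfolding proper_oriented_kernel_def Fut_singleton by blast
  then show ?thesis
    unfolding kmeasure_def Fut_singleton measure_space_def
    using assms by (intro emeasure_measure_of_sigma) auto
qed

lemma measure_kmeasure:
  assumes "A \<in> Fsets (- above y)" shows "measure (kmeasure g {y} \<omega>) A = g {y} A \<omega>"
  using emeasure_kmeasure[OF assms] kernel_range[OF assms] by (simp add: measure_def)

lemma prob_space_kmeasure: "prob_space (kmeasure g {y} \<omega>)"
proof
  have "UNIV \<in> Fsets (- above y)"
    using sets.top[of "OmegaOn (- above y)"] by simp
  moreover have "g {y} UNIV \<omega> = 1"
    using proper unfolding proper_oriented_kernel_def by blast
  ultimately show "emeasure (kmeasure g {y} \<omega>) (space (kmeasure g {y} \<omega>)) = 1"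
    using emeasure_kmeasure[of UNIV \<omega>] by (simp add: space_kmeasure)
qed

lemma measurable_kmeasure:
  "f \<in> borel_measurable (OmegaOn (- above y)) \<Longrightarrow> f \<in> borel_measurable (kmeasure g {y} \<omega>)"
  by (subst measurable_cong_sets[OF _ refl]) (auto simp: sets_kmeasure)

lemma kint_bounded:
  assumes "f \<in> borel_measurable (OmegaOn (- above y))" "\<And>\<omega>. \<bar>f \<omega>\<bar> \<le> B"
  shows "\<bar>kint g {y} f \<omega>\<bar> \<le> B"
proof -
  interpret prob_space "kmeasure g {y} \<omega>" by (rule prob_space_kmeasure)
  have "\<bar>(\<integral>\<sigma>. f \<sigma> \<partial>kmeasure g {y} \<omega>) - (\<integral>\<sigma>. 0 \<partial>kmeasure g {y} \<omega>)\<bar> \<le> B"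
    using assms by (intro integral_diff_le[of _ _ B 0] measurable_kmeasure) auto
  then show ?thesis by (simp add: kint_def)
qed

lemma kint_simple_approx:
  assumes "f \<in> borel_measurable (OmegaOn (- above y))" "\<And>\<omega>. \<bar>f \<omega>\<bar> \<le> B"
    and "finite I" "\<And>v. A v \<in> Fsets (- above y)"
    and "\<And>\<omega>. \<bar>f \<omega> - (\<Sum>v\<in>I. v * indicator (A v) \<omega>)\<bar> \<le> \<epsilon>"
  shows "\<bar>kint g {y} f \<omega> - (\<Sum>v\<in>I. v * g {y} (A v) \<omega>)\<bar> \<le> \<epsilon>"
  using integral_simple_approx[OF prob_space_kmeasure measurable_kmeasure[OF assms(1)] assms(2,3) _ assms(5)]
    assms(4) by (simp add: kint_def sets_kmeasure measure_kmeasure)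

text \<open>Properness says that \<open>\<gamma>\<^sub>y(\<cdot>, \<omega>)\<close> freezes \<open>\<omega>\<close> off \<open>y\<close> and its future; as \<open>S\<close> is countable,
  this holds simultaneously at all those sites, almost surely.\<close>

lemma kint_resample:
  assumes "quasilocal f" "\<And>\<omega>. \<bar>f \<omega>\<bar> \<le> B" "depends_on (- above y) f"
  shows "kint g {y} f \<omega> = kint g {y} (\<lambda>\<sigma>. f (fun_upd \<omega> y (\<sigma> y))) \<omega>"
  unfolding kint_def
proof (rule integral_cong_AE)
  interpret prob_space "kmeasure g {y} \<omega>" by (rule prob_space_kmeasure)
  show "f \<in> borel_measurable (kmeasure g {y} \<omega>)"
    using assms by (intro measurable_kmeasure quasilocal_measurable)
  have dep: "depends_on {y} (\<lambda>\<sigma>. f (fun_upd \<omega> y (\<sigma> y)))" by (simp add: depends_on_def)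
  show "(\<lambda>\<sigma>. f (fun_upd \<omega> y (\<sigma> y))) \<in> borel_measurable (kmeasure g {y} \<omega>)"
  proof (intro measurable_kmeasure quasilocal_measurable)
    show "quasilocal (\<lambda>\<sigma>. f (fun_upd \<omega> y (\<sigma> y)))"
      using dep by (rule finite_dependence_quasilocal[rotated]) simp
    show "depends_on (- above y) (\<lambda>\<sigma>. f (fun_upd \<omega> y (\<sigma> y)))"
      using dep by (rule depends_on_mono) (simp add: above_def)
  qed (rule assms)
  define C where "C = {\<sigma>. \<forall>x\<in>- above y - {y}. \<sigma> x = \<omega> x}"
  have C: "C \<in> Fsets (- above y - {y})" unfolding C_def by (rule cylinder_in_Fsets)
  then have C': "C \<in> Fsets (- above y)" using Fsets_mono[of "- above y - {y}" "- above y"] by auto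
  have "g {y} C \<omega> = indicator C \<omega>"
    using proper C unfolding proper_oriented_kernel_def Past_Outer_singleton by blast
  then have "prob C = 1" using C' by (simp add: measure_kmeasure C_def)
  then have "AE \<sigma> in kmeasure g {y} \<omega>. \<sigma> \<in> C" using C' by (intro AE_prob_1)
  then show "AE \<sigma> in kmeasure g {y} \<omega>. f \<sigma> = f (fun_upd \<omega> y (\<sigma> y))"
  proof eventually_elim
    case (elim \<sigma>)
    then show ?case by (intro depends_onD[OF assms(3)]) (auto simp: C_def)
  qed
qed

text \<open>Clause (c) says this for events in \<open>Fsets {y}\<close>; simple functions of the
  color at \<open>y\<close> inherit it, and \<open>h\<close> is approximated by them
  uniformly.\<close>

lemma kint_site_depends_on_below:
  assumes "\<And>\<omega>. \<bar>h \<omega>\<bar> \<le> B" "depends_on {y} h"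
  shows "depends_on (below y) (kint g {y} h)"
  unfolding depends_on_def
proof (intro allI impI)
  fix \<omega> \<sigma> :: "'s \<Rightarrow> 'e" assume eq: "\<forall>x\<in>below y. \<omega> x = \<sigma> x"
  have ql: "quasilocal h" using assms(2) by (rule finite_dependence_quasilocal[rotated]) simp
  have sub: "{y} \<subseteq> - above y" by (simp add: above_def)
  have "\<bar>kint g {y} h \<omega> - kint g {y} h \<sigma>\<bar> \<le> 0 + \<epsilon>" if e: "\<epsilon> > 0" for \<epsilon>
  proof -
    obtain L I A where *: "L \<subseteq> {y}" "finite I" "\<And>v. A v \<in> Fsets L"
      "\<And>\<omega>. \<bar>h \<omega> - (\<Sum>v\<in>I. v * indicator (A v) \<omega>)\<bar> \<le> \<epsilon> / 2"
      by (rule quasilocal_simple_approx[OF ql assms(1,2), of "\<epsilon> / 2"]) (use e in auto)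
    have A: "A v \<in> Fsets {y}" "A v \<in> Fsets (- above y)" for v
      using Fsets_mono[OF *(1)] Fsets_mono[OF sub] *(3) by blast+
    have "h \<in> borel_measurable (OmegaOn (- above y))"
      using ql assms depends_on_mono[OF assms(2) sub] by (intro quasilocal_measurable)
    from kint_simple_approx[OF this assms(1) *(2) A(2) *(4)]
    have ap: "\<bar>kint g {y} h \<omega> - (\<Sum>v\<in>I. v * g {y} (A v) \<omega>)\<bar> \<le> \<epsilon> / 2" for \<omega> .
    have "g {y} (A v) \<omega> = g {y} (A v) \<sigma>" for v
    proof -
      have "depends_on (below y) (g {y} (A v))"
        using proper A(1) measurable_depends_on
        unfolding proper_oriented_kernel_def Past_singleton by blast
      then show ?thesis by (rule depends_onD) (use eq in auto)
    qed
    then have "(\<Sum>v\<in>I. v * g {y} (A v) \<omega>) = (\<Sum>v\<in>I. v * g {y} (A v) \<sigma>)" by simp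
    then show ?thesis using ap[of \<omega>] ap[of \<sigma>] by linarith
  qed
  then have "\<bar>kint g {y} h \<omega> - kint g {y} h \<sigma>\<bar> \<le> 0" by (rule field_le_epsilon)
  then show "kint g {y} h \<omega> = kint g {y} h \<sigma>" by simp
qed

text \<open>By \<open>kint_resample\<close> the color of \<open>\<omega>\<close> at \<open>y\<close>
  is overwritten, and the law of the new color depends only on \<open>below y\<close>, which lies in
  \<open>V\<close>.\<close>

lemma kint_depends_on:
  assumes "quasilocal f" "\<And>\<omega>. \<bar>f \<omega>\<bar> \<le> B" "depends_on V f" "V \<subseteq> - above y" "below y \<subseteq> V"
  shows "depends_on (V - {y}) (kint g {y} f)"
  unfolding depends_on_def
proof (intro allI impI)
  fix \<omega> \<sigma> :: "'s \<Rightarrow> 'e" assume eq: "\<forall>x\<in>V - {y}. \<omega> x = \<sigma> x"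
  have dep: "depends_on (- above y) f" using assms(3,4) by (rule depends_on_mono)
  have "(\<lambda>\<tau>. f (fun_upd \<omega> y (\<tau> y))) = (\<lambda>\<tau>. f (fun_upd \<sigma> y (\<tau> y)))"
    using eq by (intro ext depends_onD[OF assms(3)]) auto
  moreover have "kint g {y} (\<lambda>\<tau>. f (fun_upd \<omega> y (\<tau> y))) \<omega> = kint g {y} (\<lambda>\<tau>. f (fun_upd \<omega> y (\<tau> y))) \<sigma>"
    by (rule depends_onD[OF kint_site_depends_on_below[of _ B]])
      (use assms(2,5) eq in \<open>auto simp: depends_on_def below_def\<close>)
  ultimately show "kint g {y} f \<omega> = kint g {y} f \<sigma>"
    unfolding kint_resample[OF assms(1,2) dep] by simp
qed

text \<open>Quasilocality of the kernel is given for local events only; a uniform approximation of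
  \<open>f\<close> by finite combinations of such events passes it on to functions.\<close>

lemma kint_quasilocal:
  assumes f: "quasilocal f" "\<And>\<omega>. \<bar>f \<omega>\<bar> \<le> B" "depends_on (- above y) f"
    and qlk: "\<And>A. A \<in> Fsets (- above y) \<Longrightarrow> local_event A \<Longrightarrow> quasilocal (g {y} A)"
  shows "quasilocal (kint g {y} f)"
  unfolding quasilocal_def
proof (intro allI impI)
  fix \<epsilon> :: real assume "\<epsilon> > 0"
  obtain L I A where *: "finite L" "L \<subseteq> - above y" "finite I" "\<And>v. A v \<in> Fsets L"
      "\<And>\<omega>. \<bar>f \<omega> - (\<Sum>v\<in>I. v * indicator (A v) \<omega>)\<bar> \<le> \<epsilon> / 3"
    by (rule quasilocal_simple_approx[OF f, of "\<epsilon> / 3"]) (use \<open>\<epsilon> > 0\<close> in auto)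
  have A: "A v \<in> Fsets (- above y)" for v
    using Fsets_mono[OF *(2)] *(4) by blast
  have ap: "\<bar>kint g {y} f \<omega> - (\<Sum>v\<in>I. v * g {y} (A v) \<omega>)\<bar> \<le> \<epsilon> / 3" for \<omega>
    using f *(3,5) A by (intro kint_simple_approx quasilocal_measurable)
  \<comment> \<open>The summand 1 keeps \<open>S\<close> positive even when every coefficient
    vanishes, and makes the final estimate strict.\<close>
  define S where "S = (\<Sum>v\<in>I. \<bar>v\<bar>) + 1"
  have S: "S > 0" unfolding S_def by (smt (verit) sum_nonneg abs_ge_zero)
  have "\<exists>K. finite K \<and> (\<forall>\<omega> \<sigma>. (\<forall>x\<in>K. \<omega> x = \<sigma> x) \<longrightarrow> \<bar>g {y} (A v) \<omega> - g {y} (A v) \<sigma>\<bar> < \<epsilon> / 3 / S)" for v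
    using qlk[of "A v"] A *(1,4) S \<open>\<epsilon> > 0\<close> unfolding quasilocal_def local_event_def
    by (metis divide_pos_pos zero_less_numeral)
  then obtain K where K: "\<And>v. finite (K v)"
    "\<And>v \<omega> \<sigma>. (\<forall>x\<in>K v. \<omega> x = \<sigma> x) \<Longrightarrow> \<bar>g {y} (A v) \<omega> - g {y} (A v) \<sigma>\<bar> < \<epsilon> / 3 / S"
    by metis
  show "\<exists>K. finite K \<and> (\<forall>\<omega> \<sigma>. (\<forall>x\<in>K. \<omega> x = \<sigma> x) \<longrightarrow> \<bar>kint g {y} f \<omega> - kint g {y} f \<sigma>\<bar> < \<epsilon>)"
  proof (intro exI conjI allI impI)
    show "finite (\<Union>v\<in>I. K v)" using *(3) K(1) by auto
    fix \<omega> \<sigma> :: "'s \<Rightarrow> 'e" assume eq: "\<forall>x\<in>(\<Union>v\<in>I. K v). \<omega> x = \<sigma> x"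
    have "\<bar>(\<Sum>v\<in>I. v * g {y} (A v) \<omega>) - (\<Sum>v\<in>I. v * g {y} (A v) \<sigma>)\<bar>
        = \<bar>\<Sum>v\<in>I. v * (g {y} (A v) \<omega> - g {y} (A v) \<sigma>)\<bar>"
      by (simp add: right_diff_distrib sum_subtractf)
    also have "\<dots> \<le> (\<Sum>v\<in>I. \<bar>v * (g {y} (A v) \<omega> - g {y} (A v) \<sigma>)\<bar>)" by (rule sum_abs)
    also have "\<dots> \<le> (\<Sum>v\<in>I. \<bar>v\<bar> * (\<epsilon> / 3 / S))"
      unfolding abs_mult using eq by (intro sum_mono mult_left_mono K(2)[THEN less_imp_le]) auto
    also have "\<dots> = (S - 1) * (\<epsilon> / 3 / S)"
      unfolding sum_distrib_right[symmetric] by (simp add: S_def)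
    also have "\<dots> < S * (\<epsilon> / 3 / S)" using S \<open>\<epsilon> > 0\<close> by (intro mult_strict_right_mono) auto
    also have "\<dots> = \<epsilon> / 3" using S by simp
    finally show "\<bar>kint g {y} f \<omega> - kint g {y} f \<sigma>\<bar> < \<epsilon>" using ap[of \<omega>] ap[of \<sigma>] by linarith
  qed
qed

text \<open>The invariance of \<open>\<mu>\<close>, assumed for events, extends linearly to simple
  functions and by uniform approximation to \<open>f\<close>.\<close>

lemma integral_kint_eq:
  assumes "prob_space \<mu>" and sets: "sets \<mu> = Fsets UNIV"
    and eq: "\<And>A. A \<in> Fsets (- above y) \<Longrightarrow> (\<integral>\<sigma>. g {y} A \<sigma> \<partial>\<mu>) = measure \<mu> A"
    and f: "quasilocal f" "\<And>\<omega>. \<bar>f \<omega>\<bar> \<le> B" "depends_on (- above y) f"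
    and ql: "quasilocal (kint g {y} f)"
  shows "(\<integral>\<sigma>. kint g {y} f \<sigma> \<partial>\<mu>) = (\<integral>\<sigma>. f \<sigma> \<partial>\<mu>)"
proof -
  interpret prob_space \<mu> by fact
  have meas: "h \<in> borel_measurable \<mu>" if "h \<in> borel_measurable (OmegaOn U)" for h :: "_ \<Rightarrow> real" and U
  proof -
    have "h \<in> borel_measurable (OmegaOn UNIV)"
      using measurable_mono[of borel borel "OmegaOn U" "OmegaOn UNIV"] Fsets_mono[of U UNIV] that by auto
    then show ?thesis by (subst measurable_cong_sets[OF _ refl]) (auto simp: sets)
  qed
  have mf: "f \<in> borel_measurable (OmegaOn (- above y))"
    using f by (intro quasilocal_measurable)
  have kb: "\<bar>kint g {y} f \<omega>\<bar> \<le> B" for \<omega> using mf f(2) by (rule kint_bounded)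
  have mk: "kint g {y} f \<in> borel_measurable \<mu>"
    by (rule meas[OF quasilocal_measurable[OF ql kb, of UNIV]]) simp
  have "\<bar>(\<integral>\<sigma>. kint g {y} f \<sigma> \<partial>\<mu>) - (\<integral>\<sigma>. f \<sigma> \<partial>\<mu>)\<bar> \<le> 0 + \<epsilon>" if e: "\<epsilon> > 0" for \<epsilon>
  proof -
    obtain L I A where *: "L \<subseteq> - above y" "finite I" "\<And>v. A v \<in> Fsets L"
      "\<And>\<omega>. \<bar>f \<omega> - (\<Sum>v\<in>I. v * indicator (A v) \<omega>)\<bar> \<le> \<epsilon> / 2"
      by (rule quasilocal_simple_approx[OF f, of "\<epsilon> / 2"]) (use e in auto)
    have A: "A v \<in> Fsets (- above y)" "A v \<in> sets \<mu>" for v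
      using Fsets_mono[OF *(1)] Fsets_mono[of L UNIV] *(3) sets by blast+
    have mg: "g {y} (A v) \<in> borel_measurable \<mu>" for v
      using proper A(1) unfolding proper_oriented_kernel_def Fut_singleton by (blast intro: meas)
    have ig: "integrable \<mu> (g {y} (A v))" for v
      using mg kernel_range[OF A(1)] by (intro integrable_const_bound[of _ 1]) auto
    have 1: "\<bar>(\<integral>\<sigma>. f \<sigma> \<partial>\<mu>) - (\<Sum>v\<in>I. v * measure \<mu> (A v))\<bar> \<le> \<epsilon> / 2"
      by (rule integral_simple_approx[OF assms(1) meas[OF mf] f(2) *(2) A(2) *(4)])
    \<comment> \<open>A bound on the simple approximant of \<open>kint g {y} f\<close>, needed to
      integrate it; it is inherited from the bound on the function approximated.\<close>
    have bs: "\<bar>\<Sum>v\<in>I. v * g {y} (A v) \<omega>\<bar> \<le> B + \<epsilon> / 2" for \<omega>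
      using kint_simple_approx[OF mf f(2) *(2) A(1) *(4), of \<omega>] kb[of \<omega>] by linarith
    have "\<bar>(\<integral>\<sigma>. kint g {y} f \<sigma> \<partial>\<mu>) - (\<integral>\<sigma>. (\<Sum>v\<in>I. v * g {y} (A v) \<sigma>) \<partial>\<mu>)\<bar> \<le> \<epsilon> / 2"
      using mk mg kb bs kint_simple_approx[OF mf f(2) *(2) A(1) *(4)]
      by (intro integral_diff_le) auto
    also have "(\<integral>\<sigma>. (\<Sum>v\<in>I. v * g {y} (A v) \<sigma>) \<partial>\<mu>) = (\<Sum>v\<in>I. v * measure \<mu> (A v))"
      using ig eq[OF A(1)] by (subst Bochner_Integration.integral_sum) auto
    finally show ?thesis using 1 by linarith
  qed
  then have "\<bar>(\<integral>\<sigma>. kint g {y} f \<sigma> \<partial>\<mu>) - (\<integral>\<sigma>. f \<sigma> \<partial>\<mu>)\<bar> \<le> 0" by (rule field_le_epsilon)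
  then show ?thesis by simp
qed

end

section \<open>Oscillation under resampling\<close>

text \<open>Boundedness of \<open>f\<close> is what gives the real supremum in \<open>osc\<close>
  its meaning.\<close>

lemma osc_upper:
  assumes "\<And>\<omega>. \<bar>f \<omega>\<bar> \<le> B" "\<And>z. z \<noteq> x \<Longrightarrow> \<xi> z = \<eta> z"
  shows "\<bar>f \<xi> - f \<eta>\<bar> \<le> osc x f"
  unfolding osc_def
proof (rule cSup_upper)
  have "\<bar>f \<xi> - f \<eta>\<bar> \<le> 2 * B" for \<xi> \<eta>
    using assms(1)[of \<xi>] assms(1)[of \<eta>] by linarith
  then show "bdd_above {\<bar>f \<xi> - f \<eta>\<bar> |\<xi> \<eta>. \<forall>z. z \<noteq> x \<longrightarrow> \<xi> z = \<eta> z}"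
    by (intro bdd_aboveI[of _ "2 * B"]) auto
qed (use assms(2) in auto)

lemma osc_least:
  assumes "\<And>\<xi> \<eta>. (\<And>z. z \<noteq> x \<Longrightarrow> \<xi> z = \<eta> z) \<Longrightarrow> \<bar>f \<xi> - f \<eta>\<bar> \<le> c"
  shows "osc x f \<le> c"
  unfolding osc_def by (rule cSup_least) (use assms in auto)

text \<open>A dust-rate matrix is constrained only where \<open>x \<le> y\<close>. Extension by zero
  gives a nonnegative matrix on all pairs of sites, so that sums can range over all of
  \<open>S\<close>.\<close>

definition strict_rate :: "('s::order \<Rightarrow> 's \<Rightarrow> real) \<Rightarrow> 's \<Rightarrow> 's \<Rightarrow> real" where
  "strict_rate \<alpha> y x = (if x < y then \<alpha> y x else 0)"

lemma strict_rate_nonneg: "dust_rate g \<alpha> \<Longrightarrow> 0 \<le> strict_rate \<alpha> y x"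
  unfolding dust_rate_def strict_rate_def by auto

lemma kint_oscillation:
  fixes g :: "'s::{order,countable} set \<Rightarrow> ('s \<Rightarrow> 'e::countable) set \<Rightarrow> ('s \<Rightarrow> 'e) \<Rightarrow> real"
  assumes proper: "proper_oriented_kernel (g {y}) {y}" and dust: "dust_rate g \<alpha>"
    and f: "quasilocal f" "\<And>\<omega>. \<bar>f \<omega>\<bar> \<le> B" "depends_on (- above y) f"
    and x: "x \<noteq> y"
    and dx: "\<And>\<xi> \<eta>. (\<And>z. z \<noteq> x \<Longrightarrow> \<xi> z = \<eta> z) \<Longrightarrow> \<bar>f \<xi> - f \<eta>\<bar> \<le> dx"
    and dy: "\<And>\<xi> \<eta>. (\<And>z. z \<noteq> y \<Longrightarrow> \<xi> z = \<eta> z) \<Longrightarrow> \<bar>f \<xi> - f \<eta>\<bar> \<le> dy"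
    and eq: "\<And>z. z \<noteq> x \<Longrightarrow> \<xi> z = \<eta> z"
  shows "\<bar>kint g {y} f \<xi> - kint g {y} f \<eta>\<bar> \<le> dx + dy * strict_rate \<alpha> y x"
proof -
  define h where "h \<tau> \<sigma> = f (fun_upd \<tau> y (\<sigma> y))" for \<tau> \<sigma>
  have hd: "depends_on {y} (h \<tau>)" for \<tau> by (simp add: depends_on_def h_def)
  have hb: "\<bar>h \<tau> \<sigma>\<bar> \<le> B" for \<tau> \<sigma> unfolding h_def by (rule f(2))
  have hm: "h \<tau> \<in> borel_measurable (OmegaOn U)" if "y \<in> U" for \<tau> U
    using that hd by (intro quasilocal_measurable[OF finite_dependence_quasilocal[OF _ hd] hb])
      (auto intro: depends_on_mono)
  have hm': "h \<tau> \<in> borel_measurable (kmeasure g {y} \<sigma>)" for \<tau> \<sigma>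
    by (intro measurable_kmeasure[of g, OF proper] hm) (simp add: above_def)
  have kb: "\<bar>kint g {y} (h \<tau>) \<sigma>\<bar> \<le> B" for \<tau> \<sigma>
    using hb by (intro kint_bounded[of g, OF proper] hm) (simp_all add: above_def)
  have r: "kint g {y} f \<tau> = kint g {y} (h \<tau>) \<tau>" for \<tau>
    unfolding h_def by (rule kint_resample[of g, OF proper f])
  \<comment> \<open>Same integrand, different boundary condition. If \<open>x\<close> is not below
    \<open>y\<close>, the law at \<open>y\<close> does not see the change.\<close>
  have 1: "\<bar>kint g {y} (h \<xi>) \<xi> - kint g {y} (h \<xi>) \<eta>\<bar> \<le> dy * strict_rate \<alpha> y x"
  proof (cases "x < y")
    case True
    have "\<bar>kint g {y} (h \<xi>) \<xi> - kint g {y} (h \<xi>) \<eta>\<bar> \<le> osc x (kint g {y} (h \<xi>))"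
      using kb eq by (rule osc_upper)
    also have "\<dots> \<le> osc y (h \<xi>) * \<alpha> y x"
      using dust True hm[of "{y}" \<xi>] hb[of \<xi>] unfolding dust_rate_def by blast
    also have "\<dots> \<le> dy * \<alpha> y x"
    proof (rule mult_right_mono)
      show "osc y (h \<xi>) \<le> dy" unfolding h_def by (intro osc_least dy) auto
      show "0 \<le> \<alpha> y x" using dust True unfolding dust_rate_def by auto
    qed
    finally show ?thesis using True by (simp add: strict_rate_def)
  next
    case False
    have "kint g {y} (h \<xi>) \<xi> = kint g {y} (h \<xi>) \<eta>"
      by (rule depends_onD[OF kint_site_depends_on_below[of g, OF proper hb hd]])
        (use eq False in \<open>auto simp: below_def\<close>)
    then show ?thesis using False by (simp add: strict_rate_def)
  qed
  \<comment> \<open>Same boundary condition; the integrands are \<open>f\<close> at configurations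
    that can differ only at \<open>x\<close>.\<close>
  have 2: "\<bar>kint g {y} (h \<xi>) \<eta> - kint g {y} (h \<eta>) \<eta>\<bar> \<le> dx"
    unfolding kint_def
  proof (rule prob_space.integral_diff_le[OF prob_space_kmeasure[of g, OF proper] hm' hm' hb hb])
    show "\<bar>h \<xi> \<sigma> - h \<eta> \<sigma>\<bar> \<le> dx" for \<sigma> unfolding h_def using eq by (intro dx) auto
  qed
  show ?thesis using 1 2 unfolding r by linarith
qed

section \<open>Comparison of two Gibbs measures by resampling and freezing\<close>

lemma Gibbs_measurable:
  fixes f :: "('s::{order,countable} \<Rightarrow> 'e::countable) \<Rightarrow> real"
  assumes "\<mu> \<in> Gibbs g" "quasilocal f" "\<And>\<omega>. \<bar>f \<omega>\<bar> \<le> B"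
  shows "f \<in> borel_measurable \<mu>"
proof -
  have "f \<in> borel_measurable (OmegaOn UNIV)"
    using assms(2,3) by (rule quasilocal_measurable) simp
  then show ?thesis
    using assms(1) by (subst measurable_cong_sets[OF _ refl]) (auto simp: Gibbs_def)
qed

lemma Gibbs_integral_kint:
  fixes f :: "('s::{order,countable} \<Rightarrow> 'e::countable) \<Rightarrow> real"
  assumes "proper_oriented_kernel (g {y}) {y}" "\<mu> \<in> Gibbs g"
    and "quasilocal f" "\<And>\<omega>. \<bar>f \<omega>\<bar> \<le> B" "depends_on (- above y) f" "quasilocal (kint g {y} f)"
  shows "(\<integral>\<sigma>. kint g {y} f \<sigma> \<partial>\<mu>) = (\<integral>\<sigma>. f \<sigma> \<partial>\<mu>)"
  using assms(2) time_box_singleton[of y] unfolding Gibbs_def Fut_singleton[symmetric]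
  by (intro integral_kint_eq[of g, OF assms(1) _ _ _ assms(3-6)]) (auto simp: Fut_singleton[symmetric])

text \<open>\<open>X\<close> holds the sites still to be resampled, and \<open>V\<close> those neither resampled nor frozen yet.
  Each site is frozen at most once, so the total cost is paid by the mass of \<open>M\<close> on \<open>V - X\<close>.\<close>

lemma Gibbs_integral_diff_le:
  fixes g :: "'s::{order,countable} set \<Rightarrow> ('s \<Rightarrow> 'e::countable) set \<Rightarrow> ('s \<Rightarrow> 'e) \<Rightarrow> real"
  assumes proper: "\<And>y. proper_oriented_kernel (g {y}) {y}" and qlk: "quasilocal_POS g"
    and dust: "dust_rate g \<alpha>" and \<mu>: "\<mu> \<in> Gibbs g" and \<nu>: "\<nu> \<in> Gibbs g"
    and M: "M summable_on UNIV" "\<And>x. 0 \<le> M x"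
    and "finite X" "X \<subseteq> V" and down: "\<And>x z. x \<in> V \<Longrightarrow> z \<le> x \<Longrightarrow> z \<in> V"
    and "quasilocal f" "\<And>\<omega>. \<bar>f \<omega>\<bar> \<le> B" "depends_on V f"
    and "\<And>x \<xi> \<eta>. x \<in> V \<Longrightarrow> (\<And>z. z \<noteq> x \<Longrightarrow> \<xi> z = \<eta> z) \<Longrightarrow> \<bar>f \<xi> - f \<eta>\<bar> \<le> d x"
    and "\<And>x. x \<in> V \<Longrightarrow> d x + (\<Sum>y\<in>X. M y * strict_rate \<alpha> y x) \<le> M x"
  shows "\<bar>(\<integral>\<sigma>. f \<sigma> \<partial>\<mu>) - (\<integral>\<sigma>. f \<sigma> \<partial>\<nu>)\<bar> \<le> 2 * infsum M (V - X)"
  using assms(8-15)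
proof (induction "card X" arbitrary: X V f d)
  have summ: "M summable_on U" for U using M(1) by (rule summable_on_subset_banach) simp
  {
    case 0
    then have X: "X = {}" by simp
    define \<omega>0 :: "'s \<Rightarrow> 'e" where "\<omega>0 = undefined"
    have dM: "d x \<le> M x" if "x \<in> V" for x using 0(9)[OF that] by (simp add: X)
    have b: "\<bar>f \<omega> - f \<omega>0\<bar> \<le> infsum M V" for \<omega>
    proof -
      \<comment> \<open>Sites outside \<open>V\<close> are reset to \<open>\<omega>0\<close>, which
        \<open>f\<close> does not notice; the remaining changes lie in \<open>V\<close>, where
        \<open>M\<close> bounds the oscillation.\<close>
      define \<tau> where "\<tau> x = (if x \<in> V then \<omega> x else \<omega>0 x)" for x
      have "\<bar>f \<tau> - f \<omega>0\<bar> \<le> infsum M V"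
      proof (rule quasilocal_diff_le_infsum[OF 0(5)])
        fix x and \<xi> \<eta> :: "'s \<Rightarrow> 'e" assume *: "x \<in> V" "\<And>z. z \<noteq> x \<Longrightarrow> \<xi> z = \<eta> z"
        have "\<bar>f \<xi> - f \<eta>\<bar> \<le> d x" using * by (rule 0(8))
        then show "\<bar>f \<xi> - f \<eta>\<bar> \<le> M x" using dM[OF *(1)] by linarith
      qed (use 0 summ M(2) in \<open>auto simp: \<tau>_def\<close>)
      moreover have "f \<omega> = f \<tau>" using 0(7) by (rule depends_onD) (simp add: \<tau>_def)
      ultimately show ?thesis by simp
    qed
    have "\<bar>(\<integral>\<sigma>. f \<sigma> \<partial>P) - f \<omega>0\<bar> \<le> infsum M V" if "P \<in> Gibbs g" for P
    proof -
      interpret prob_space P using that by (auto simp: Gibbs_def)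
      have "\<bar>(\<integral>\<sigma>. f \<sigma> \<partial>P) - (\<integral>\<sigma>. f \<omega>0 \<partial>P)\<bar> \<le> infsum M V"
        using Gibbs_measurable[OF that 0(5,6)] 0(6) b by (intro integral_diff_le) auto
      then show ?thesis by (simp add: prob_space)
    qed
    from this[OF \<mu>] this[OF \<nu>] show ?case by (simp add: X)
  next
    case (Suc n)
    note down = Suc.prems(3) and ql = Suc.prems(4) and bd = Suc.prems(5) and dep = Suc.prems(6)
      and osc = Suc.prems(7) and mass = Suc.prems(8)
    have "X \<noteq> {}" using Suc.hyps(2) by auto
    \<comment> \<open>Maximality of \<open>y\<close> in \<open>X\<close> ensures that the sites
      above \<open>y\<close>, about to be frozen, are none of those still to be resampled.\<close>
    then obtain y where y: "y \<in> X" "\<And>z. z \<in> X \<Longrightarrow> y \<le> z \<Longrightarrow> y = z"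
      using finite_has_maximal[OF Suc.prems(1)] by metis
    define W where "W = V \<inter> above y"
    \<comment> \<open>Removing the whole up-set of \<open>y\<close> keeps the set of remaining sites
      closed downwards.\<close>
    define V' where "V' = V - {x. y \<le> x}"
    have V': "V' = V - W - {y}" by (auto simp: V'_def W_def above_def)
    have yV: "y \<in> V" using y(1) Suc.prems(2) by auto
    have a0: "0 \<le> strict_rate \<alpha> z x" for z x using dust by (rule strict_rate_nonneg)
    have dM: "d x \<le> M x" if "x \<in> V" for x
      using mass[OF that] sum_nonneg[of X "\<lambda>z. M z * strict_rate \<alpha> z x"] M(2) a0 by auto
    define F where "F \<omega> x = (if x \<in> W then undefined else \<omega> x)" for \<omega> :: "'s \<Rightarrow> 'e" and x
    \<comment> \<open>Freezing \<open>W\<close> brings the function into the domain of the kernel at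
      \<open>y\<close>, which sees only events off the future of \<open>y\<close>.\<close>
    define f1 where "f1 \<omega> = f (F \<omega>)" for \<omega>
    have ql1: "quasilocal f1" unfolding quasilocal_def
    proof (intro allI impI)
      fix \<epsilon> :: real assume "\<epsilon> > 0"
      then obtain L where "finite L" "\<And>\<omega> \<sigma>. (\<forall>x\<in>L. \<omega> x = \<sigma> x) \<Longrightarrow> \<bar>f \<omega> - f \<sigma>\<bar> < \<epsilon>"
        using ql unfolding quasilocal_def by meson
      then show "\<exists>L. finite L \<and> (\<forall>\<omega> \<sigma>. (\<forall>x\<in>L. \<omega> x = \<sigma> x) \<longrightarrow> \<bar>f1 \<omega> - f1 \<sigma>\<bar> < \<epsilon>)"
        unfolding f1_def by (intro exI[of _ L]) (auto simp: F_def)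
    qed
    have bd1: "\<bar>f1 \<omega>\<bar> \<le> B" for \<omega> unfolding f1_def by (rule bd)
    have dep1: "depends_on (V - W) f1"
      unfolding depends_on_def f1_def
      by (intro allI impI depends_onD[OF dep]) (auto simp: F_def)
    have dep1': "depends_on (- above y) f1"
      using dep1 by (rule depends_on_mono) (auto simp: W_def)
    have osc1: "\<bar>f1 \<xi> - f1 \<eta>\<bar> \<le> d x" if "x \<in> V" "\<And>z. z \<noteq> x \<Longrightarrow> \<xi> z = \<eta> z" for x \<xi> \<eta>
      unfolding f1_def using that by (intro osc) (auto simp: F_def)
    have close: "\<bar>f \<omega> - f1 \<omega>\<bar> \<le> infsum M W" for \<omega>
      unfolding f1_def
    proof (rule quasilocal_diff_le_infsum[OF ql])
      fix x and \<xi> \<eta> :: "'s \<Rightarrow> 'e" assume *: "x \<in> W" "\<And>z. z \<noteq> x \<Longrightarrow> \<xi> z = \<eta> z"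
      have "\<bar>f \<xi> - f \<eta>\<bar> \<le> d x" using * by (intro osc) (auto simp: W_def)
      then show "\<bar>f \<xi> - f \<eta>\<bar> \<le> M x" using dM[of x] * by (auto simp: W_def)
    qed (use summ M(2) in \<open>auto simp: F_def\<close>)
    have freeze: "\<bar>(\<integral>\<sigma>. f \<sigma> \<partial>P) - (\<integral>\<sigma>. f1 \<sigma> \<partial>P)\<bar> \<le> infsum M W" if "P \<in> Gibbs g" for P
    proof -
      interpret prob_space P using that by (auto simp: Gibbs_def)
      show ?thesis
        using Gibbs_measurable[OF that ql bd] Gibbs_measurable[OF that ql1 bd1] bd bd1 close
        by (rule integral_diff_le)
    qed
    define f2 where "f2 = kint g {y} f1"
    have ql2: "quasilocal f2" unfolding f2_def
    proof (rule kint_quasilocal[of g, OF proper ql1 bd1 dep1'])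
      show "quasilocal (g {y} A)" if "A \<in> Fsets (- above y)" "local_event A" for A
        using qlk that time_box_singleton[of y]
        unfolding quasilocal_POS_def Fut_singleton[symmetric] by blast
    qed
    have m1: "f1 \<in> borel_measurable (OmegaOn (- above y))"
      using ql1 bd1 dep1' by (rule quasilocal_measurable)
    have bd2: "\<bar>f2 \<omega>\<bar> \<le> B" for \<omega>
      unfolding f2_def using m1 bd1 by (rule kint_bounded[of g, OF proper])
    have dep2: "depends_on V' f2"
      unfolding V' f2_def
      by (rule kint_depends_on[of g, OF proper ql1 bd1 dep1])
        (use down[OF yV] in \<open>auto simp: W_def above_def below_def\<close>)
    have I: "(\<integral>\<sigma>. f1 \<sigma> \<partial>P) = (\<integral>\<sigma>. f2 \<sigma> \<partial>P)" if "P \<in> Gibbs g" for P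
      unfolding f2_def
      using Gibbs_integral_kint[of g, OF proper that ql1 bd1 dep1'] ql2 by (simp add: f2_def)
    have "\<bar>(\<integral>\<sigma>. f2 \<sigma> \<partial>\<mu>) - (\<integral>\<sigma>. f2 \<sigma> \<partial>\<nu>)\<bar> \<le> 2 * infsum M (V' - (X - {y}))"
    \<comment> \<open>Since \<open>d y \<le> M y\<close>, the oscillation added by resampling
      \<open>y\<close> is at most the summand of \<open>y\<close> in the budget inequality. That
      summand moves from the sum over \<open>X\<close> into the new oscillation bound, and the
      budget \<open>M\<close> stays the same.\<close>
    proof (rule Suc.hyps(1)[of _ _ _ "\<lambda>x. d x + M y * strict_rate \<alpha> y x"])
      show "n = card (X - {y})" using Suc.hyps(2) y(1) by simp
      show "X - {y} \<subseteq> V'" using Suc.prems(2) y(2) by (auto simp: V'_def)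
      show "z \<in> V'" if "x \<in> V'" "z \<le> x" for x z
        using that down by (auto simp: V'_def dest: order_trans)
      show "\<bar>f2 \<xi> - f2 \<eta>\<bar> \<le> d x + M y * strict_rate \<alpha> y x"
        if x: "x \<in> V'" and eq: "\<And>z. z \<noteq> x \<Longrightarrow> \<xi> z = \<eta> z" for x \<xi> \<eta>
      proof -
        have "x \<in> V" "x \<noteq> y" using x by (auto simp: V'_def)
        then have "\<bar>f2 \<xi> - f2 \<eta>\<bar> \<le> d x + d y * strict_rate \<alpha> y x"
          unfolding f2_def using eq
          by (intro kint_oscillation[OF proper dust ql1 bd1 dep1'] osc1 yV)
        also have "\<dots> \<le> d x + M y * strict_rate \<alpha> y x"
          using dM[OF yV] a0 by (intro add_left_mono mult_right_mono)
        finally show ?thesis .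
      qed
      show "d x + M y * strict_rate \<alpha> y x + (\<Sum>z\<in>X - {y}. M z * strict_rate \<alpha> z x) \<le> M x"
        if "x \<in> V'" for x
        using mass[of x] that sum.remove[OF Suc.prems(1) y(1), of "\<lambda>z. M z * strict_rate \<alpha> z x"]
        by (auto simp: V'_def)
    qed (use Suc.prems(1) ql2 bd2 dep2 in auto)
    \<comment> \<open>The sites frozen now and those charged later partition \<open>V - X\<close>;
      the factor 2 accounts for the two measures.\<close>
    moreover have "infsum M W + infsum M (V' - (X - {y})) = infsum M (V - X)"
    proof -
      have "infsum M (W \<union> (V' - (X - {y}))) = infsum M W + infsum M (V' - (X - {y}))"
        by (intro infsum_Un_disjoint summ) (auto simp: V')
      moreover have "W \<union> (V' - (X - {y})) = V - X"
        using y by (fastforce simp: V' W_def above_def)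
      ultimately show ?thesis by simp
    qed
    ultimately show ?case
      using freeze[OF \<mu>] freeze[OF \<nu>] unfolding I[OF \<mu>] I[OF \<nu>] by linarith
  }
qed

section \<open>Construction of the dominating mass\<close>

text \<open>A bridge to extended nonnegative integrals against counting measure, where sums may be
  interchanged without convergence conditions.\<close>

lemma summable_nn_integral:
  fixes f :: "'a \<Rightarrow> real"
  assumes "\<And>x. 0 \<le> f x" "f summable_on UNIV"
  shows "(\<integral>\<^sup>+x. ennreal (f x) \<partial>count_space UNIV) = ennreal (infsum f UNIV)"
proof -
  have "Infinite_Set_Sum.abs_summable_on f UNIV"
    using assms by (simp add: abs_summable_equivalent[symmetric])
  then show ?thesis
    using assms by (simp add: nn_integral_conv_infsetsum infsetsum_infsum)
qed

lemma nn_integral_imp_summable: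
  fixes f :: "'a \<Rightarrow> real"
  assumes "\<And>x. 0 \<le> f x" "(\<integral>\<^sup>+x. ennreal (f x) \<partial>count_space UNIV) < \<infinity>"
  shows "f summable_on UNIV"
proof -
  have "Infinite_Set_Sum.abs_summable_on f UNIV"
    unfolding Infinite_Set_Sum.abs_summable_on_def
    using assms by (intro integrableI_bounded) auto
  then show ?thesis
    using assms by (simp add: abs_summable_equivalent[symmetric])
qed

text \<open>\<open>M\<close> is the potential \<open>\<Sum>\<^sub>n c a\<^sup>n\<close> of the substochastic matrix \<open>a\<close>.\<close>

lemma dust_mass_exists:
  fixes a :: "'s::countable \<Rightarrow> 's \<Rightarrow> real" and c :: "'s \<Rightarrow> real"
  assumes a: "\<And>y x. 0 \<le> a y x" and c: "\<And>x. 0 \<le> c x"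
    and row: "\<And>y. (\<integral>\<^sup>+x. ennreal (a y x) \<partial>count_space UNIV) \<le> ennreal r" and r: "0 \<le> r" "r < 1"
    and fin: "c summable_on UNIV"
  obtains M where "M summable_on UNIV" "\<And>x. 0 \<le> M x"
    "\<And>X x. finite X \<Longrightarrow> c x + (\<Sum>y\<in>X. M y * a y x) \<le> M x"
proof -
  let ?I = "nn_integral (count_space UNIV)"
  \<comment> \<open>\<open>T\<close> multiplies a row vector by the matrix \<open>a\<close>, so
    \<open>m n\<close> is \<open>c\<close> times the \<open>n\<close>-th power of
    \<open>a\<close>.\<close>
  define T where "T m x = ?I (\<lambda>y. m y * ennreal (a y x))" for m :: "'s \<Rightarrow> ennreal" and x
  define m where "m n = (T ^^ n) (\<lambda>x. ennreal (c x))" for n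
  define N where "N x = (\<Sum>n. m n x)" for x
  \<comment> \<open>Exchanging the sums brings out the row sums of \<open>a\<close>, so each
    application of \<open>T\<close> shrinks total mass by the factor \<open>r\<close>; the masses of
    the \<open>m n\<close> are then dominated by a geometric series.\<close>
  have IT: "?I (T p) \<le> ?I p * ennreal r" for p
  proof -
    have "?I (T p) = (\<integral>\<^sup>+y. \<integral>\<^sup>+x. p y * ennreal (a y x) \<partial>count_space UNIV \<partial>count_space UNIV)"
      unfolding T_def by (rule nn_integral_count_space_nn_integral) auto
    also have "\<dots> = (\<integral>\<^sup>+y. p y * ?I (\<lambda>x. ennreal (a y x)) \<partial>count_space UNIV)"
      by (simp add: nn_integral_cmult)
    also have "\<dots> \<le> (\<integral>\<^sup>+y. p y * ennreal r \<partial>count_space UNIV)"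
      using row by (intro nn_integral_mono mult_left_mono) auto
    also have "\<dots> = ?I p * ennreal r" by (simp add: nn_integral_multc)
    finally show ?thesis .
  qed
  have m0: "m 0 = (\<lambda>x. ennreal (c x))" by (simp add: m_def)
  have mS: "m (Suc n) = T (m n)" for n by (simp add: m_def)
  define K where "K = ?I (m 0)"
  have K: "K < \<infinity>" using summable_nn_integral[OF c fin] by (simp add: K_def m0)
  have Im: "?I (m n) \<le> K * ennreal (r ^ n)" for n
  proof (induction n)
    case 0
    then show ?case by (simp add: K_def)
  next
    case (Suc n)
    have "?I (m (Suc n)) \<le> ?I (m n) * ennreal r" unfolding mS by (rule IT)
    also have "\<dots> \<le> K * ennreal (r ^ n) * ennreal r" using Suc by (intro mult_right_mono) auto
    also have "\<dots> = K * ennreal (r ^ Suc n)"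
      using r by (simp add: ennreal_mult ac_simps)
    finally show ?case .
  qed
  have "?I N = (\<Sum>n. ?I (m n))" unfolding N_def by (rule nn_integral_suminf) simp
  also have "\<dots> \<le> (\<Sum>n. K * ennreal (r ^ n))" using Im by (intro suminf_le) auto
  also have "\<dots> = K * (\<Sum>n. ennreal (r ^ n))" by simp
  also have "(\<Sum>n. ennreal (r ^ n)) = ennreal (1 / (1 - r))"
    using r by (intro suminf_ennreal_eq geometric_sums) auto
  also have "K * ennreal (1 / (1 - r)) < \<infinity>" using K by (simp add: ennreal_mult_less_top)
  finally have IN: "?I N < \<infinity>" .
  \<comment> \<open>Finite total mass bounds every single value, which allows the return to real
    numbers.\<close>
  have Nfin: "N x < \<infinity>" for x
    using nn_integral_ge_point[of x UNIV N] IN by (auto simp: le_less_trans)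
  \<comment> \<open>The potential solves \<open>N = c + T N\<close>: splitting off the term at 0
    leaves the shifted series, and \<open>T\<close> commutes with countable sums. Restricting
    \<open>T N\<close> to \<open>X\<close> then gives the required inequality.\<close>
  have NT: "N x = ennreal (c x) + T N x" for x
  proof -
    have "N x = m 0 x + (\<Sum>n. m (Suc n) x)" 
      unfolding N_def using suminf_offset[of "\<lambda>n. m n x" 1] by (simp add: add.commute)
    also have "(\<Sum>n. m (Suc n) x) = T N x"
      unfolding mS T_def N_def by (simp flip: nn_integral_suminf ennreal_suminf_multc)
    finally show ?thesis by (simp add: m0)
  qed
  define M where "M x = enn2real (N x)" for x
  have eM: "ennreal (M x) = N x" for x unfolding M_def using Nfin[of x] by simp
  show ?thesis
  proof (rule that)
    show M0: "0 \<le> M x" for x by (simp add: M_def)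
    show "M summable_on UNIV" by (rule nn_integral_imp_summable) (use M0 IN in \<open>auto simp: eM\<close>)
    fix X :: "'s set" and x assume X: "finite X"
    have "ennreal (c x + (\<Sum>y\<in>X. M y * a y x)) = ennreal (c x) + (\<Sum>y\<in>X. N y * ennreal (a y x))"
      using M0 a c by (simp add: sum_nonneg eM[symmetric] ennreal_mult sum_ennreal[symmetric])
    also have "(\<Sum>y\<in>X. N y * ennreal (a y x)) = (\<integral>\<^sup>+y. N y * ennreal (a y x) \<partial>count_space X)"
      using X by (simp add: nn_integral_count_space_finite)
    also have "\<dots> \<le> T N x"
      unfolding T_def by (subst nn_integral_count_space_indicator) (auto intro!: nn_integral_mono split: split_indicator)
    finally have "ennreal (c x + (\<Sum>y\<in>X. M y * a y x)) \<le> ennreal (M x)"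
      unfolding eM NT[of x] by (simp add: add_left_mono)
    then show "c x + (\<Sum>y\<in>X. M y * a y x) \<le> M x" using M0 by (simp add: ennreal_le_iff)
  qed
qed

text \<open>The supremum itself serves as \<open>r\<close>: being below 1 it is finite, so it
  converts to a real number that bounds all row sums.\<close>

lemma dust_rate_row_sum:
  assumes dust: "dust_rate g \<alpha>"
    and sup: "(SUP y. (\<Sum>\<^sub>\<infinity>x\<in>{x. x \<le> y}. ennreal (\<alpha> y x))) < 1"
  obtains r where "0 \<le> r" "r < 1"
    "\<And>y. (\<integral>\<^sup>+x. ennreal (strict_rate \<alpha> y x) \<partial>count_space UNIV) \<le> ennreal r"
proof -
  define G where "G = (SUP y. (\<Sum>\<^sub>\<infinity>x\<in>{x. x \<le> y}. ennreal (\<alpha> y x)))"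
  define r where "r = enn2real G"
  have G: "G < 1" using sup by (simp add: G_def)
  then have "G < top" by (rule less_trans) simp
  then have rG: "ennreal r = G" unfolding r_def by simp
  have r: "0 \<le> r" by (simp add: r_def)
  have r1: "r < 1" using G r unfolding rG[symmetric] by (simp add: ennreal_less_one_iff)
  note a0 = strict_rate_nonneg[OF dust]
  have F: "sum (strict_rate \<alpha> y) F \<le> r" if "finite F" for y F
  proof -
    have "ennreal (sum (strict_rate \<alpha> y) F) = (\<Sum>x\<in>F. ennreal (strict_rate \<alpha> y x))"
      using a0 by simp
    \<comment> \<open>Only sites strictly below \<open>y\<close> contribute, and they form a finite
      subset of the index set of the infinite sum.\<close>
    also have "\<dots> = (\<Sum>x\<in>F \<inter> {x. x < y}. ennreal (\<alpha> y x))"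
      using that by (intro sum.mono_neutral_cong_right) (auto simp: strict_rate_def)
    also have "\<dots> \<le> (SUP F\<in>{F. finite F \<and> F \<subseteq> {x. x \<le> y}}. \<Sum>x\<in>F. ennreal (\<alpha> y x))"
      using that by (intro SUP_upper) auto
    also have "\<dots> = (\<Sum>\<^sub>\<infinity>x\<in>{x. x \<le> y}. ennreal (\<alpha> y x))"
      by (rule nonneg_infsum_complete[symmetric]) simp
    also have "\<dots> \<le> ennreal r" unfolding rG G_def by (rule SUP_upper) simp
    finally show ?thesis using r by (simp add: ennreal_le_iff)
  qed
  have S: "strict_rate \<alpha> y summable_on UNIV" for y
    using a0 F by (intro nonneg_bdd_above_summable_on bdd_aboveI[of _ r]) auto
  show ?thesis
  proof (rule that[OF r r1])
    show "(\<integral>\<^sup>+x. ennreal (strict_rate \<alpha> y x) \<partial>count_space UNIV) \<le> ennreal r" for y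
      unfolding summable_nn_integral[OF a0 S]
      using S F by (intro ennreal_leI infsum_le_finite_sums) auto
  qed
qed

section \<open>Uniqueness on local events and on the full sigma-algebra\<close>

text \<open>The indicator of \<open>A\<close> has oscillation at most 1 on \<open>L\<close> and 0
  elsewhere, so \<open>M\<close> is built from the initial vector
  \<open>c = indicator L\<close>.\<close>

lemma Gibbs_cylinder_eq:
  fixes g :: "'s::{order,countable} set \<Rightarrow> ('s \<Rightarrow> 'e::countable) set \<Rightarrow> ('s \<Rightarrow> 'e) \<Rightarrow> real"
  assumes proper: "\<And>y. proper_oriented_kernel (g {y}) {y}" and qlk: "quasilocal_POS g"
    and dust: "dust_rate g \<alpha>"
    and sup: "(SUP y. (\<Sum>\<^sub>\<infinity>x\<in>{x. x \<le> y}. ennreal (\<alpha> y x))) < 1"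
    and \<mu>: "\<mu> \<in> Gibbs g" and \<nu>: "\<nu> \<in> Gibbs g"
    and A: "finite L" "A \<in> Fsets L"
  shows "measure \<mu> A = measure \<nu> A"
proof -
  obtain r where r: "0 \<le> r" "r < 1"
    "\<And>y. (\<integral>\<^sup>+x. ennreal (strict_rate \<alpha> y x) \<partial>count_space UNIV) \<le> ennreal r"
    using dust_rate_row_sum[OF dust sup] by blast
  define c :: "'s \<Rightarrow> real" where "c = indicator L"
  have c0: "0 \<le> c x" for x by (simp add: c_def)
  have "c summable_on UNIV \<longleftrightarrow> c summable_on L"
    by (rule summable_on_cong_neutral) (auto simp: c_def)
  then have cs: "c summable_on UNIV" using A(1) by simp
  obtain M where M: "M summable_on UNIV" "\<And>x. 0 \<le> M x"
    "\<And>X x. finite X \<Longrightarrow> c x + (\<Sum>y\<in>X. M y * strict_rate \<alpha> y x) \<le> M x"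
    using dust_mass_exists[of "strict_rate \<alpha>" c, OF strict_rate_nonneg[OF dust] c0 r(3,1,2) cs] by blast
  define f :: "('s \<Rightarrow> 'e) \<Rightarrow> real" where "f = indicator A"
  have dep: "depends_on L f"
    using Fsets_depends_on[OF A(2)] by (auto simp: depends_on_def f_def indicator_def)
  have osc: "\<bar>f \<xi> - f \<eta>\<bar> \<le> c x" if "\<And>z. z \<noteq> x \<Longrightarrow> \<xi> z = \<eta> z" for x \<xi> \<eta>
  proof (cases "x \<in> L")
    case True
    then show ?thesis by (simp add: c_def f_def indicator_def)
  next
    case False
    then have "f \<xi> = f \<eta>" by (intro depends_onD[OF dep] that) auto
    then show ?thesis by (simp add: c_def)
  qed
  have "\<bar>(\<integral>\<sigma>. f \<sigma> \<partial>\<mu>) - (\<integral>\<sigma>. f \<sigma> \<partial>\<nu>)\<bar> \<le> 0 + \<epsilon>" if "\<epsilon> > 0" for \<epsilon>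
  proof -
    \<comment> \<open>Summability of \<open>M\<close> leaves mass at most
      \<open>\<epsilon> / 2\<close> outside a finite set; the factor 2 in the comparison turns this
      into \<open>\<epsilon>\<close>.\<close>
    obtain X where X: "finite X" "dist (sum M X) (infsum M UNIV) \<le> \<epsilon> / 2"
      using infsum_finite_approximation[OF M(1), of "\<epsilon> / 2"] \<open>\<epsilon> > 0\<close> by auto
    have "infsum M (UNIV - X) = infsum M UNIV - infsum M X"
      using X(1) M(1) by (intro infsum_Diff) auto
    then have tail: "infsum M (UNIV - X) \<le> \<epsilon> / 2"
      using X(2) infsum_finite[OF X(1), of M] unfolding dist_real_def by linarith
    have "\<bar>(\<integral>\<sigma>. f \<sigma> \<partial>\<mu>) - (\<integral>\<sigma>. f \<sigma> \<partial>\<nu>)\<bar> \<le> 2 * infsum M (UNIV - X)"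
    \<comment> \<open>Here \<open>V\<close> is all of \<open>S\<close>, which is trivially closed
      downwards, and the initial oscillation bound \<open>d\<close> is \<open>c\<close>.\<close>
    proof (rule Gibbs_integral_diff_le[OF proper qlk dust \<mu> \<nu> M(1,2) X(1)])
      show "quasilocal f" using A(1) dep by (rule finite_dependence_quasilocal)
      show "\<bar>f \<omega>\<bar> \<le> 1" for \<omega> by (simp add: f_def indicator_def)
      show "\<bar>f \<xi> - f \<eta>\<bar> \<le> c x" if "\<And>z. z \<noteq> x \<Longrightarrow> \<xi> z = \<eta> z" for x \<xi> \<eta> using that by (rule osc)
      show "c x + (\<Sum>y\<in>X. M y * strict_rate \<alpha> y x) \<le> M x" for x using X(1) by (rule M(3))
    qed auto
    then show ?thesis using tail by linarith
  qed
  then have "\<bar>(\<integral>\<sigma>. f \<sigma> \<partial>\<mu>) - (\<integral>\<sigma>. f \<sigma> \<partial>\<nu>)\<bar> \<le> 0" by (rule field_le_epsilon)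
  moreover have "(\<integral>\<sigma>. f \<sigma> \<partial>P) = measure P A" if "P \<in> Gibbs g" for P
  proof -
    have "sets P = sets (OmegaOn UNIV)" using that by (simp add: Gibbs_def)
    from sets_eq_imp_space_eq[OF this] have "space P = UNIV" by simp
    then show ?thesis by (simp add: f_def)
  qed
  ultimately show ?thesis using \<mu> \<nu> by simp
qed

theorem mainTheorem12:
  fixes \<gamma> :: "'s::{order,countable} set \<Rightarrow> ('s \<Rightarrow> 'e::countable) set \<Rightarrow> ('s \<Rightarrow> 'e) \<Rightarrow> real"
    and \<alpha> :: "'s \<Rightarrow> 's \<Rightarrow> real"
  assumes "standing_assms TYPE('s)"
    and "is_POS \<gamma>"
    and "quasilocal_POS \<gamma>"
    and "dust_rate \<gamma> \<alpha>"
    and "(SUP y. (\<Sum>\<^sub>\<infinity>x\<in>{x. x \<le> y}. ennreal (\<alpha> y x))) < 1"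
  shows "\<forall>\<mu>\<in>Gibbs \<gamma>. \<forall>\<nu>\<in>Gibbs \<gamma>. \<mu> = \<nu>"
proof (intro ballI)
  fix \<mu> \<nu> assume \<mu>: "\<mu> \<in> Gibbs \<gamma>" and \<nu>: "\<nu> \<in> Gibbs \<gamma>"
  \<comment> \<open>The local events: they generate the full sigma-algebra and are stable under
    intersection, since events on \<open>L\<close> and on \<open>K\<close> both live on
    \<open>L \<union> K\<close>.\<close>
  define C :: "('s \<Rightarrow> 'e) set set" where "C = (\<Union>L\<in>Collect finite. Fsets L)"
  have proper: "proper_oriented_kernel (\<gamma> {y}) {y}" for y
    using assms(2) time_box_singleton unfolding is_POS_def by blast
  interpret M: prob_space \<mu> using \<mu> by (simp add: Gibbs_def)
  interpret N: prob_space \<nu> using \<nu> by (simp add: Gibbs_def)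
  have FC: "Fsets UNIV = sigma_sets UNIV C"
  proof
    have "{{\<omega>. \<omega> x = e} |x e. x \<in> UNIV} \<subseteq> C"
    proof clarify
      fix x :: 's and e :: 'e
      have "{\<omega>. \<omega> x = e} \<in> Fsets {x}" unfolding Fsets_def by (intro sigma_sets.Basic) auto
      then show "{\<omega>. \<omega> x = e} \<in> C" unfolding C_def by blast
    qed
    then show "Fsets UNIV \<subseteq> sigma_sets UNIV C"
      unfolding Fsets_def by (rule sigma_sets_mono')
    have "C \<subseteq> Fsets UNIV" unfolding C_def using Fsets_mono by blast
    then show "sigma_sets UNIV C \<subseteq> Fsets UNIV"
      unfolding Fsets_def by (rule sigma_sets_mono)
  qed
  show "\<mu> = \<nu>"
  \<comment> \<open>Finite measures agreeing on an intersection-stable generator coincide; the whole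
    space is itself a local event, so the constant sequence exhausts it.\<close>
  proof (rule measure_eqI_generator_eq[where \<Omega> = UNIV and E = C and A = "\<lambda>_. UNIV"])
    show "Int_stable C"
    proof (rule Int_stableI)
      fix A B assume "A \<in> C" "B \<in> C"
      then obtain L K where "finite L" "A \<in> Fsets L" "finite K" "B \<in> Fsets K"
        unfolding C_def by auto
      moreover from this have "A \<in> sets (OmegaOn (L \<union> K))" "B \<in> sets (OmegaOn (L \<union> K))"
        using Fsets_mono[of L "L \<union> K"] Fsets_mono[of K "L \<union> K"] by auto
      then have "A \<inter> B \<in> sets (OmegaOn (L \<union> K))" by (rule sets.Int)
      ultimately show "A \<inter> B \<in> C" unfolding C_def by auto
    qed
    show "sets \<mu> = sigma_sets UNIV C" "sets \<nu> = sigma_sets UNIV C"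
      using \<mu> \<nu> by (simp_all add: Gibbs_def FC)
    show "emeasure \<mu> A = emeasure \<nu> A" if "A \<in> C" for A
      using that Gibbs_cylinder_eq[OF proper assms(3-5) \<mu> \<nu>]
      unfolding C_def M.emeasure_eq_measure N.emeasure_eq_measure by auto
    have "UNIV \<in> Fsets ({} :: 's set)" using sets.top[of "OmegaOn {}"] by simp
    then show "range (\<lambda>_. UNIV) \<subseteq> C" unfolding C_def by auto
  qed auto
qed

end
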